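(* Let $k\ge2$ and let $W_a$ be the affine Weyl group of type $\widetilde B_k$ acting on $V=\mathbb{R}^k$, with fundamental alcove $\mathcal A=\{x\in\mathbb{R}^k:x_1>\cdots>x_k>0,\ x_1+x_2<1\}$. Let $X=(X^1,\dots,X^k)$ be a reflectable process in $\mathbb{R}^k$ (with respect to $W_a$) having independent components in orthogonal directions, let $x\in\mathcal A$, and let $\widetilde T$ be the first exit time of $X$ from $\mathcal A$. Then for every $t\ge0$ $$\mathbb{P}_x(\widetilde T>t)=\begin{cases}\mathrm{Pf}(\bar p_{ij})_{i,j\in[k]} & \text{if $k$ is even},\\[2pt] \displaystyle\sum_{l=1}^k(-1)^{l-1}\,\bar p_l\,\mathrm{Pf}(\bar p_{ij})_{i,j\in[k]\setminus\{l\}} & \text{if $k$ is odd},\end{cases}$$ where for $i<j$, $\bar p_{ij}=\mathbb{P}_x(\forall s\le t,\ 1-X^j_s>X^i_s>X^j_s>0)$, $\bar p_{ji}=-\bar p_{ij}$, and $\bar p_i=\mathbb{P}_x(\forall s\le t,\ 1>X^i_s>0)$.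
   Context: $[k]=\{1,\dots,k\}$. $W_a$ consists of the maps $x\mapsto w(x)+d$, with $w$ a signed permutation of the coordinates of $\mathbb{R}^k$ and $d\in L=\{d\in\mathbb{Z}^k:\sum_id_i\text{ is even}\}$. $X=(X_t)_{t\ge0}$ has law $\mathbb{P}_x$ when started at $x$; it is reflectable if it has the strong Markov property, almost surely continuous sample paths, and $W_a$-invariant law: $\mathbb{P}_x\circ(wX)^{-1}=\mathbb{P}_{wx}\circ X^{-1}$ for all $w\in W_a$, $x\in V$. "Independent components in orthogonal directions" means that under each $\mathbb{P}_x$ the projections of $X$ onto pairwise orthogonal subspaces are independent processes. $\mathrm{Pf}$ denotes the Pfaffian: $\mathrm{Pf}(a_{ij})=\sum_\pi(-1)^{c(\pi)}\prod_{\{i<j\}\in\pi}a_{ij}$, summed over partitions $\pi$ of the (ordered) index set into pairs, $c(\pi)$ being the number of crossings (pairs of blocks $\{i<j\},\{i'<j'\}$ with $i<i'<j<j'$). *)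

theory Defs
  imports "HOL-Probability.Probability"
begin

text \<open>
  The index set \<open>[k]\<close> is rendered by a finite linearly ordered type \<open>'k\<close> with \<open>k = CARD('k)\<close>, so
  that \<open>V = real ^ 'k\<close>.
\<close>

definition affine_weyl_B :: "(real ^ 'k \<Rightarrow> real ^ 'k) set" where
  "affine_weyl_B =
    {w. \<exists>(\<sigma> :: 'k \<Rightarrow> 'k) (\<epsilon> :: 'k \<Rightarrow> real) (d :: int ^ 'k).
      bij \<sigma> \<and> (\<forall>i. \<epsilon> i \<in> {-1, 1}) \<and> even (\<Sum>i\<in>UNIV. d $ i) \<and>
      w = (\<lambda>x. \<chi> i. \<epsilon> i * x $ \<sigma> i + of_int (d $ i))}"

text \<open>The first and the second index; the latter is meaningful only if \<open>CARD('k) \<ge> 2\<close>.\<close>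

definition index1 :: "'k::{finite,linorder}" where
  "index1 = Min UNIV"

definition index2 :: "'k::{finite,linorder}" where
  "index2 = Min (UNIV - {index1})"

definition alcove_B :: "(real ^ 'k::{finite,linorder}) set" where
  "alcove_B = {x. (\<forall>i j. i < j \<longrightarrow> x $ i > x $ j) \<and> (\<forall>i. x $ i > 0) \<and> x $ index1 + x $ index2 < 1}"

text \<open>
  A process with time set \<open>{0..}\<close> is a function \<open>X\<close> on a measurable space \<open>M\<close> (the values \<open>X t\<close> for
  \<open>t < 0\<close> play no role), together with a family \<open>P\<close> of probability measures on \<open>M\<close> indexed by the
  starting point. Laws of processes are measures on the product sigma-algebra.
\<close>

definition path_space :: "(real \<Rightarrow> 'v::topological_space) measure" where
  "path_space = Pi\<^sub>M {0..} (\<lambda>_. borel)"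

definition path :: "(real \<Rightarrow> 'w \<Rightarrow> 'v) \<Rightarrow> 'w \<Rightarrow> real \<Rightarrow> 'v" where
  "path X \<omega> = (\<lambda>t\<in>{0..}. X t \<omega>)"

definition process_law ::
  "('v \<Rightarrow> 'w measure) \<Rightarrow> (real \<Rightarrow> 'w \<Rightarrow> 'v::topological_space) \<Rightarrow> 'v \<Rightarrow> (real \<Rightarrow> 'v) measure" where
  "process_law P X x = distr (P x) path_space (path X)"

text \<open>
  Continuity of paths is only required almost surely, so events that involve uncountably many times
  are measurable only with respect to the completed probability measures. All probabilities of such
  events are therefore taken in the completion.
\<close>

definition cprob :: "('v \<Rightarrow> 'w measure) \<Rightarrow> 'v \<Rightarrow> ('w \<Rightarrow> bool) \<Rightarrow> real" where
  "cprob P x E = measure (completion (P x)) {\<omega> \<in> space (P x). E \<omega>}"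

definition process_family ::
  "'w measure \<Rightarrow> ('v \<Rightarrow> 'w measure) \<Rightarrow> (real \<Rightarrow> 'w \<Rightarrow> 'v::topological_space) \<Rightarrow> bool" where
  "process_family M P X \<longleftrightarrow>
    (\<forall>x. prob_space (P x) \<and> sets (P x) = sets M) \<and>
    (\<forall>t\<ge>0. X t \<in> borel_measurable M) \<and>
    (\<forall>x. AE \<omega> in P x. X 0 \<omega> = x)"

text \<open>
  Stopping times take values in \<open>[0, \<infinity>]\<close>, that is in \<open>ennreal\<close>. The filtration is the raw natural
  one; the strong Markov property with respect to any larger filtration implies the one below.
\<close>

definition natural_filtration ::
  "'w measure \<Rightarrow> (real \<Rightarrow> 'w \<Rightarrow> 'v::topological_space) \<Rightarrow> ennreal \<Rightarrow> 'w measure" where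
  "natural_filtration M X u =
    sigma (space M) {X s -` B \<inter> space M | s B. 0 \<le> s \<and> ennreal s \<le> u \<and> B \<in> sets borel}"

lemma filtration_natural_filtration: "filtration (space M) (natural_filtration M X)"
proof
  show "space (natural_filtration M X u) = space M" for u
    unfolding natural_filtration_def by (rule space_measure_of) auto
  show "sets (natural_filtration M X u) \<subseteq> sets (natural_filtration M X v)" if "u \<le> v" for u v
    unfolding natural_filtration_def using that
    by (subst (1 2) sets_measure_of) (auto intro!: sigma_sets_mono' intro: order_trans)
qed

text \<open>
  The equation states, in integrated form, that on \<open>{T < \<infinity>}\<close> the conditional law of
  \<open>(X\<^bsub>T+s\<^esub>)\<^bsub>s\<ge>0\<^esub>\<close> given \<open>\<F>\<^sub>T\<close> is the law of the process started at \<open>X\<^sub>T\<close>.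
\<close>

definition strong_markov ::
  "'w measure \<Rightarrow> ('v \<Rightarrow> 'w measure) \<Rightarrow> (real \<Rightarrow> 'w \<Rightarrow> 'v::topological_space) \<Rightarrow> bool" where
  "strong_markov M P X \<longleftrightarrow>
    process_law P X \<in> borel \<rightarrow>\<^sub>M prob_algebra path_space \<and>
    (\<forall>x T A C.
      stopping_time (natural_filtration M X) T \<longrightarrow>
      A \<in> sets (filtration.pre_sigma (space M) (natural_filtration M X) T) \<longrightarrow>
      C \<in> sets path_space \<longrightarrow>
      emeasure (completion (P x))
        {\<omega> \<in> A. T \<omega> < \<infinity> \<and> path (\<lambda>s. X (enn2real (T \<omega>) + s)) \<omega> \<in> C} =
      (\<integral>\<^sup>+ \<omega>. emeasure (process_law P X (X (enn2real (T \<omega>)) \<omega>)) C * indicator {\<omega> \<in> A. T \<omega> < \<infinity>} \<omega>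
        \<partial>completion (P x)))"

definition reflectable ::
  "'w measure \<Rightarrow> (real ^ 'k \<Rightarrow> 'w measure) \<Rightarrow> (real \<Rightarrow> 'w \<Rightarrow> real ^ 'k) \<Rightarrow> bool" where
  "reflectable M P X \<longleftrightarrow>
    process_family M P X \<and>
    strong_markov M P X \<and>
    (\<forall>x. AE \<omega> in P x. continuous_on {0..} (\<lambda>t. X t \<omega>)) \<and>
    (\<forall>w\<in>affine_weyl_B. \<forall>x.
      distr (P x) path_space (path (\<lambda>t \<omega>. w (X t \<omega>))) = process_law P X (w x))"

definition orth_proj :: "'v::euclidean_space set \<Rightarrow> 'v \<Rightarrow> 'v" where
  "orth_proj U x = (THE y. y \<in> U \<and> (\<forall>u\<in>U. orthogonal (x - y) u))"

definition independent_orthogonal_components ::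
  "('v \<Rightarrow> 'w measure) \<Rightarrow> (real \<Rightarrow> 'w \<Rightarrow> 'v::euclidean_space) \<Rightarrow> bool" where
  "independent_orthogonal_components P X \<longleftrightarrow>
    (\<forall>x \<U>. (\<forall>U\<in>\<U>. subspace U) \<longrightarrow>
      pairwise (\<lambda>U U'. \<forall>u\<in>U. \<forall>u'\<in>U'. orthogonal u u') \<U> \<longrightarrow>
      prob_space.indep_vars (P x) (\<lambda>_. path_space) (\<lambda>U. path (\<lambda>t \<omega>. orth_proj U (X t \<omega>))) \<U>)"

definition exit_time :: "(real \<Rightarrow> 'w \<Rightarrow> 'v) \<Rightarrow> 'v set \<Rightarrow> 'w \<Rightarrow> ennreal" where
  "exit_time X A \<omega> = Inf (ennreal ` {s. 0 \<le> s \<and> X s \<omega> \<notin> A})"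

definition pair_partitions :: "'i set \<Rightarrow> 'i set set set" where
  "pair_partitions I = {\<pi>. partition_on I \<pi> \<and> (\<forall>b\<in>\<pi>. card b = 2)}"

definition crossings :: "'i::linorder set set \<Rightarrow> nat" where
  "crossings \<pi> =
    card {(b, b'). b \<in> \<pi> \<and> b' \<in> \<pi> \<and> Min b < Min b' \<and> Min b' < Max b \<and> Max b < Max b'}"

definition Pf :: "('i::linorder \<Rightarrow> 'i \<Rightarrow> real) \<Rightarrow> 'i set \<Rightarrow> real" where
  "Pf a I = (\<Sum>\<pi>\<in>pair_partitions I. (-1) ^ crossings \<pi> * (\<Prod>b\<in>\<pi>. a (Min b) (Max b)))"

definition pbar1 ::
  "(real ^ 'k \<Rightarrow> 'w measure) \<Rightarrow> (real \<Rightarrow> 'w \<Rightarrow> real ^ 'k) \<Rightarrow> real ^ 'k \<Rightarrow> real \<Rightarrow> 'k \<Rightarrow> real" where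
  "pbar1 P X x t i = cprob P x (\<lambda>\<omega>. \<forall>s\<in>{0..t}. 1 > X s \<omega> $ i \<and> X s \<omega> $ i > 0)"

definition pbar_upper ::
  "(real ^ 'k \<Rightarrow> 'w measure) \<Rightarrow> (real \<Rightarrow> 'w \<Rightarrow> real ^ 'k) \<Rightarrow> real ^ 'k \<Rightarrow> real \<Rightarrow>
    'k \<Rightarrow> 'k \<Rightarrow> real" where
  "pbar_upper P X x t i j = cprob P x
    (\<lambda>\<omega>. \<forall>s\<in>{0..t}. 1 - X s \<omega> $ j > X s \<omega> $ i \<and> X s \<omega> $ i > X s \<omega> $ j \<and> X s \<omega> $ j > 0)"

definition pbar2 ::
  "(real ^ 'k::{finite,linorder} \<Rightarrow> 'w measure) \<Rightarrow> (real \<Rightarrow> 'w \<Rightarrow> real ^ 'k::{finite,linorder}) \<Rightarrow>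
    real ^ 'k::{finite,linorder} \<Rightarrow> real \<Rightarrow> 'k \<Rightarrow> 'k \<Rightarrow> real" where
  "pbar2 P X x t i j =
    (if i < j then pbar_upper P X x t i j
     else if j < i then - pbar_upper P X x t j i
     else 0)"

end

theory Submission
  imports Defs
begin

text \<open>
  For \<open>k\<close> even, independence of the components turns the Pfaffian into \<open>\<Sum>\<^sub>\<pi> (-1)\<^bsup>c(\<pi>)\<^esup> \<P>\<^sub>x(E\<^sub>\<pi>)\<close>, where
  \<open>E\<^sub>\<pi>\<close> is the event that up to time \<open>t\<close> every pair \<open>i < j\<close> of \<open>\<pi>\<close> satisfies \<open>1 - X\<^sup>j > X\<^sup>i > X\<^sup>j > 0\<close>. As long
  as \<open>X\<close> stays in the alcove all \<open>E\<^sub>\<pi>\<close> occur, and the signs add up to 1. After the exit the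
  contributions cancel: at the exit time \<open>X\<close> lies on a wall. On \<open>x\<^sub>k = 0\<close> every \<open>E\<^sub>\<pi>\<close> fails. On
  \<open>x\<^sub>i = x\<^bsub>i+1\<^esub>\<close> or \<open>x\<^sub>1 + x\<^sub>2 = 1\<close> the strong Markov property and the invariance under the reflection in
  that wall identify the contributions of \<open>\<pi>\<close> and of the partition obtained by exchanging \<open>i, i+1\<close> (or
  \<open>1, 2\<close>). Its sign is opposite unless the two indices form a block, in which case \<open>E\<^sub>\<pi>\<close> fails.
  For \<open>k\<close> odd the same argument applies to partitions with one additional singleton \<open>l\<close>, which carries the
  condition \<open>0 < X\<^sup>l < 1\<close> and the sign \<open>(-1)\<^bsup>l-1\<^esup>\<close>.
\<close>

section \<open>Signs of pair partitions\<close>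

text \<open>The reflection in x_1 + x_2 = 1 sends (x_1, x_2) to (1 - x_2, 1 - x_1). It can act on
  the blocks as a mere exchange of 1 and 2 because the interval allotted to the upper coordinate,
  from x_j to 1 - x_j for a pair and from 0 to 1 for a singleton, is symmetric about 1/2. The
  analytic obstacle is that after an exit at time T only the random time t - T remains, whereas the
  strong Markov property is stated for fixed sets of future paths. It is therefore first extended to
  measurable sets of pairs (T, future path). Moreover, the path space carries only the product
  sigma-algebra, and paths are continuous only almost surely. So staying in an open set is expressed
  by a positive lower bound, at rational times, on the distance to the complement, and events are
  compared through the completed measure.\<close>

abbreviation swap :: "'a \<Rightarrow> 'a \<Rightarrow> 'a \<Rightarrow> 'a" where
  "swap \<equiv> Transposition.transpose"

lemma pair_partition_blockE:
  assumes "\<pi> \<in> pair_partitions I" "b \<in> \<pi>"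
  obtains u v where "u < v" "b = {u, v}" "Min b = u" "Max b = v" "u \<in> I" "v \<in> I"
proof -
  have "card b = 2" and sub: "b \<subseteq> I"
    using assms by (auto simp: pair_partitions_def partition_on_def)
  then obtain p q where pq: "b = {p, q}" "p \<noteq> q" by (auto simp: card_2_iff)
  show thesis
  proof (cases "p < q")
    case True
    then show thesis using pq sub by (intro that[of p q]) auto
  next
    case False
    then show thesis using pq sub by (intro that[of q p]) auto
  qed
qed

lemma pair_partitions_same_block:
  "\<lbrakk>\<pi> \<in> pair_partitions I; b \<in> \<pi>; b' \<in> \<pi>; u \<in> b; u \<in> b'\<rbrakk> \<Longrightarrow> b = b'"
  by (auto simp: pair_partitions_def partition_on_def disjoint_def)

lemma finite_pair_partitions: "finite I \<Longrightarrow> finite (pair_partitions I)"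
  by (rule finite_subset[of _ "Pow (Pow I)"]) (auto simp: pair_partitions_def partition_on_def)

lemma finite_pair_partition: "finite I \<Longrightarrow> \<pi> \<in> pair_partitions I \<Longrightarrow> finite \<pi>"
  by (rule finite_subset[of _ "Pow I"]) (auto simp: pair_partitions_def partition_on_def)

lemma finite_crossing_set:
  "finite \<pi> \<Longrightarrow> finite {(b, b'). b \<in> \<pi> \<and> b' \<in> \<pi> \<and> P b b'}"
  by (rule finite_subset[of _ "\<pi> \<times> \<pi>"]) auto

lemma image_pair_partition:
  assumes "\<pi> \<in> pair_partitions I" "inj_on f I"
  shows "(`) f ` \<pi> \<in> pair_partitions (f ` I)"
proof -
  have "partition_on (f ` I) ((`) f ` \<pi>)"
  proof (rule partition_onI)
    show "\<Union> ((`) f ` \<pi>) = f ` I"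
      using assms(1) by (auto simp: pair_partitions_def partition_on_def)
    show "{} \<notin> (`) f ` \<pi>"
      using assms(1) by (auto simp: pair_partitions_def partition_on_def)
    fix p q assume "p \<in> (`) f ` \<pi>" "q \<in> (`) f ` \<pi>" and ne: "p \<noteq> q"
    then obtain b c where bc: "b \<in> \<pi>" "c \<in> \<pi>" "p = f ` b" "q = f ` c" by auto
    with ne have "b \<noteq> c" by auto
    with bc assms(1) have "b \<subseteq> I" "c \<subseteq> I" "b \<inter> c = {}"
      by (auto simp: pair_partitions_def partition_on_def disjoint_def)
    then show "disjnt p q"
      using inj_on_image_Int[OF assms(2), of b c] bc by (simp add: disjnt_def)
  qed
  moreover have "card (f ` b) = 2" if "b \<in> \<pi>" for b
    using assms that
    by (subst card_image) (auto simp: pair_partitions_def partition_on_def intro: inj_on_subset)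
  ultimately show ?thesis by (auto simp: pair_partitions_def)
qed

text \<open>This serves the case where one of the two exchanged indices is the singleton: on the
  paired indices the exchange is then monotone, and the sign has to change through the singleton
  alone.\<close>

lemma crossings_image_strict_mono:
  assumes \<pi>: "\<pi> \<in> pair_partitions I" and f: "strict_mono_on I f"
  shows "crossings ((`) f ` \<pi>) = crossings \<pi>"
proof -
  have mm: "Min (f ` b) = f (Min b) \<and> Max (f ` b) = f (Max b) \<and> Min b \<in> I \<and> Max b \<in> I" if b: "b \<in> \<pi>" for b
  proof -
    obtain u v where uv: "u < v" "b = {u, v}" "Min b = u" "Max b = v" "u \<in> I" "v \<in> I"
      using pair_partition_blockE[OF \<pi> b] .
    then have "f u < f v" using f by (auto simp: strict_mono_on_def)
    then show ?thesis using uv by auto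
  qed
  have iff: "f u < f v \<longleftrightarrow> u < v" if "u \<in> I" "v \<in> I" for u v
    using f that by (metis strict_mono_on_less)
  have inj: "inj_on f I" using f by (rule strict_mono_on_imp_inj_on)
  have inj2: "inj_on ((`) f) \<pi>"
    using inj \<pi> by (intro inj_on_image) (auto simp: pair_partitions_def partition_on_def)
  let ?C = "\<lambda>\<pi>. {(b, b'). b \<in> \<pi> \<and> b' \<in> \<pi> \<and> Min b < Min b' \<and> Min b' < Max b \<and> Max b < Max b'}"
  have "?C ((`) f ` \<pi>) = map_prod ((`) f) ((`) f) ` ?C \<pi>"
    by (auto simp: mm iff image_iff Bex_def)
  moreover have "inj_on (map_prod ((`) f) ((`) f)) (?C \<pi>)"
    by (rule inj_on_subset[OF map_prod_inj_on[OF inj2 inj2]]) auto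
  ultimately show ?thesis
    unfolding crossings_def by (simp add: card_image)
qed

text \<open>Every element of \<open>I\<close> other than \<open>i\<close> and \<open>j\<close> lies
  on the same side of both, so the exchange can reverse only the order of \<open>i\<close> and
  \<open>j\<close> themselves.\<close>

lemma transpose_less_transpose:
  assumes "i < j" "\<forall>m\<in>I. \<not> (i < m \<and> m < j)" "u \<in> I" "v \<in> I" "u < v" "\<not> (u = i \<and> v = j)"
  shows "swap i j u < swap i j (v::'i::linorder)"
proof -
  have "u = i \<or> u = j \<or> u < i \<or> j < u" "v = i \<or> v = j \<or> v < i \<or> j < v"
    using assms(2-4) by (metis linorder_neqE)+
  then show ?thesis
    using assms(1,5,6)
    by (elim disjE) (auto simp: Transposition.transpose_def)
qed

text \<open>Whether two blocks cross depends on comparisons between their endpoints, and the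
  exchange reverses only the comparison of \<open>i\<close> with \<open>j\<close>. Hence every pair
  of blocks keeps its status except the block \<open>A\<close> of \<open>i\<close> together with the
  block \<open>B\<close> of \<open>j\<close>, which changes it, so the parity of the number of
  crossings flips.\<close>

lemma crossings_transpose:
  fixes i j :: "'i::linorder"
  assumes fin: "finite I" and \<pi>: "\<pi> \<in> pair_partitions I" and I: "i \<in> I" "j \<in> I" and ij: "i < j"
    and adj: "\<forall>m\<in>I. \<not> (i < m \<and> m < j)" and nb: "{i, j} \<notin> \<pi>"
  shows "(-1::real) ^ crossings ((`) (swap i j) ` \<pi>) = - ((-1) ^ crossings \<pi>)"
proof -
  let ?t = "swap i j"
  let ?f = "(`) ?t"
  define cr where "cr = (\<lambda>b b'. Min b < Min b' \<and> Min b' < Max b \<and> Max b < (Max b' :: 'i))"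
  define C where "C = (\<lambda>\<pi>. {(b, b'). b \<in> \<pi> \<and> b' \<in> \<pi> \<and> cr b b'})"
  have C: "crossings \<rho> = card (C \<rho>)" for \<rho>
    by (simp add: crossings_def C_def cr_def)
  have U: "\<Union> \<pi> = I" using \<pi> by (auto simp: pair_partitions_def partition_on_def)
  obtain A B where AB: "A \<in> \<pi>" "i \<in> A" "B \<in> \<pi>" "j \<in> B"
    using U I by auto
  note same = pair_partitions_same_block[OF \<pi>]
  have ne: "A \<noteq> B"
  proof
    assume "A = B"
    moreover obtain u v where "A = {u, v}" using pair_partition_blockE[OF \<pi> AB(1)] .
    ultimately have "A = {i, j}" using AB ij by auto
    with nb AB show False by simp
  qed
  obtain a where a: "A = {i, a}" "a \<noteq> i" "a \<in> I"
    using AB by - (rule pair_partition_blockE[OF \<pi> AB(1)], auto)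
  obtain c where c: "B = {j, c}" "c \<noteq> j" "c \<in> I"
    using AB by - (rule pair_partition_blockE[OF \<pi> AB(3)], auto)
  have disj: "a \<noteq> j" "c \<noteq> i" "a \<noteq> c"
    using same[OF AB(1,3)] a c ne AB by auto
  have mm: "Min (?t ` b) = ?t (Min b) \<and> Max (?t ` b) = ?t (Max b) \<and> Min b \<in> I \<and> Max b \<in> I
    \<and> Min b \<in> b \<and> Max b \<in> b" if b: "b \<in> \<pi>" for b
  proof -
    obtain u v where uv: "u < v" "b = {u, v}" "Min b = u" "Max b = v" "u \<in> I" "v \<in> I"
      using pair_partition_blockE[OF \<pi> b] .
    then have "?t u < ?t v"
      using nb b by (intro transpose_less_transpose[OF ij adj]) auto
    then show ?thesis using uv by auto
  qed
  have iff: "?t u < ?t v \<longleftrightarrow> u < v" if "u \<in> I" "v \<in> I" "{u, v} \<noteq> {i, j}" for u v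
  proof (cases u v rule: linorder_cases)
    case less
    then show ?thesis
      using that transpose_less_transpose[where u = u and v = v, OF ij adj] by auto
  next
    case greater
    then have "?t v < ?t u"
      using that by (intro transpose_less_transpose[OF ij adj]) auto
    then show ?thesis using greater by auto
  qed simp
  have cr_iff: "cr (?t ` b) (?t ` b') \<longleftrightarrow> cr b b'"
    if b: "b \<in> \<pi>" "b' \<in> \<pi>" and nAB: "(b, b') \<noteq> (A, B)" "(b, b') \<noteq> (B, A)" for b b'
  proof (cases "b = b'")
    case True
    then show ?thesis by (auto simp: cr_def)
  next
    case False
    have nn: "{u, v} \<noteq> {i, j}" if uv: "u \<in> b" "v \<in> b'" for u v
    proof
      assume "{u, v} = {i, j}"
      then consider "i \<in> b" "j \<in> b'" | "j \<in> b" "i \<in> b'"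
        using uv by (auto simp: doubleton_eq_iff)
      then show False
      proof cases
        case 1
        then show False using same[OF b(1) AB(1) _ AB(2)] same[OF b(2) AB(3) _ AB(4)] nAB by blast
      next
        case 2
        then show False using same[OF b(1) AB(3) _ AB(4)] same[OF b(2) AB(1) _ AB(2)] nAB by blast
      qed
    qed
    have "{Min b', Max b} \<noteq> {i, j}"
      using nn[of "Max b" "Min b'"] mm[OF b(1)] mm[OF b(2)] by (simp add: insert_commute)
    then show ?thesis
      using mm[OF b(1)] mm[OF b(2)] iff[OF _ _ nn, of "Min b" "Min b'"] iff[OF _ _ nn, of "Max b" "Max b'"]
        iff[of "Min b'" "Max b"] unfolding cr_def by metis
  qed
  have inj: "inj ?f" by (rule injI) (metis inj_image_eq_iff inj_transpose)
  define D where "D = C \<pi> - {(A, B), (B, A)}"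
  have fpi: "finite \<pi>" using finite_pair_partition[OF fin \<pi>] .
  have finC: "finite (C \<pi>)" "finite (C (?f ` \<pi>))"
    using fpi by (auto simp: C_def intro!: finite_crossing_set)
  have D': "C (?f ` \<pi>) - {(?f A, ?f B), (?f B, ?f A)} = map_prod ?f ?f ` D"
  proof (intro set_eqI iffI)
    fix z assume z: "z \<in> C (?f ` \<pi>) - {(?f A, ?f B), (?f B, ?f A)}"
    then obtain b b' where b: "z = (?f b, ?f b')" "b \<in> \<pi>" "b' \<in> \<pi>" "cr (?f b) (?f b')"
      by (auto simp: C_def)
    moreover have "(b, b') \<noteq> (A, B)" "(b, b') \<noteq> (B, A)" using z b(1) by auto
    ultimately have "(b, b') \<in> D" using cr_iff[of b b'] by (simp add: C_def D_def)
    then show "z \<in> map_prod ?f ?f ` D" using b(1) by force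
  next
    fix z assume "z \<in> map_prod ?f ?f ` D"
    then obtain b b' where b: "z = (?f b, ?f b')" "b \<in> \<pi>" "b' \<in> \<pi>" "cr b b'"
        "(b, b') \<noteq> (A, B)" "(b, b') \<noteq> (B, A)"
      by (auto simp: C_def D_def)
    then show "z \<in> C (?f ` \<pi>) - {(?f A, ?f B), (?f B, ?f A)}"
      using cr_iff[of b b'] by (auto simp: C_def inj_eq[OF inj])
  qed
  have cardD: "card (map_prod ?f ?f ` D) = card D"
    using inj by (intro card_image inj_on_subset[OF prod.inj_map]) auto
  \<comment> \<open>\<open>cr p q\<close> and \<open>cr q p\<close> exclude each other, so two
    blocks account for at most one crossing.\<close>
  have split: "card (C \<rho>) = card (C \<rho> - {(p, q), (q, p)}) + of_bool (cr p q \<or> cr q p)"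
    if "p \<in> \<rho>" "q \<in> \<rho>" "finite (C \<rho>)" for \<rho> p q
  proof -
    have "C \<rho> = (C \<rho> - {(p, q), (q, p)}) \<union> (C \<rho> \<inter> {(p, q), (q, p)})" by auto
    then have "card (C \<rho>) = card (C \<rho> - {(p, q), (q, p)}) + card (C \<rho> \<inter> {(p, q), (q, p)})"
      using that by (metis Int_Diff_disjoint card_Un_disjoint finite_Diff finite_Int inf_commute)
    moreover have "C \<rho> \<inter> {(p, q), (q, p)} = (if cr p q then {(p, q)} else if cr q p then {(q, p)} else {})"
      using that by (auto simp: C_def cr_def)
    ultimately show ?thesis by auto
  qed
  have fA: "?f A = {j, a}" "?f B = {i, c}"
    using a c disj by (auto simp: Transposition.transpose_def)
  \<comment> \<open>The partners \<open>a\<close> and \<open>c\<close> lie outside the gap between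
    \<open>i\<close> and \<open>j\<close>. In each arrangement the exchange turns nested or
    separated blocks into crossing ones and vice versa.\<close>
  have tog: "(cr (?f A) (?f B) \<or> cr (?f B) (?f A)) \<longleftrightarrow> \<not> (cr A B \<or> cr B A)"
  proof -
    have 1: "a < i \<or> j < a" using adj a disj by (metis linorder_neqE)
    have 2: "c < i \<or> j < c" using adj c disj by (metis linorder_neqE)
    have 3: "a < c \<or> c < a" using disj by auto
    have mm_a: "a < i \<Longrightarrow> a < j \<and> Min {i, a} = a \<and> Max {i, a} = i \<and> Min {j, a} = a \<and> Max {j, a} = j"
      "j < a \<Longrightarrow> i < a \<and> Min {i, a} = i \<and> Max {i, a} = a \<and> Min {j, a} = j \<and> Max {j, a} = a"
      using ij by auto
    have mm_c: "c < i \<Longrightarrow> c < j \<and> Min {i, c} = c \<and> Max {i, c} = i \<and> Min {j, c} = c \<and> Max {j, c} = j"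
      "j < c \<Longrightarrow> i < c \<and> Min {i, c} = i \<and> Max {i, c} = c \<and> Min {j, c} = j \<and> Max {j, c} = c"
      using ij by auto
    have asym: "\<not> v < u" if "u < v" for u v :: 'i using that by auto
    show ?thesis
      unfolding fA unfolding a(1) c(1) cr_def using 1 2
      using 3 ij mm_a mm_c asym[of a i] asym[of j a] asym[of c i] asym[of j c] asym[of a c] asym[of c a]
        asym[of i j] asym[of a j] asym[of i a] asym[of c j] asym[of i c]
      by (elim disjE) simp_all
  qed
  have "card (C \<pi>) + card (C (?f ` \<pi>)) = 2 * card D + 1"
    using split[OF AB(1,3) finC(1)] split[of "?f A" "?f ` \<pi>" "?f B"] AB finC tog D' cardD
    by (auto simp: D_def)
  then have "odd (card (C \<pi>) + card (C (?f ` \<pi>)))" by simp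
  then show ?thesis unfolding C by (auto simp: uminus_power_if)
qed

text \<open>Reindexing along the involution gives \<open>sum g S = - sum g S\<close>. Fixed points
  are harmless, since \<open>g\<close> vanishes there.\<close>

lemma sum_eq_0_sign_reversing:
  fixes g :: "'a \<Rightarrow> real"
  assumes "\<And>x. x \<in> S \<Longrightarrow> \<tau> x \<in> S" "\<And>x. x \<in> S \<Longrightarrow> \<tau> (\<tau> x) = x" "\<And>x. x \<in> S \<Longrightarrow> g (\<tau> x) = - g x"
  shows "sum g S = 0"
proof -
  have "sum g S = (\<Sum>x\<in>S. - g x)"
    by (rule sum.reindex_bij_witness[of _ \<tau> \<tau>]) (use assms in auto)
  then show ?thesis by (simp add: sum_negf)
qed

lemma transpose_pair_partition:
  assumes "\<pi> \<in> pair_partitions I" "i \<in> I" "j \<in> I"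
  shows "(`) (swap i j) ` \<pi> \<in> pair_partitions I"
  using image_pair_partition[OF assms(1), of "swap i j"] assms(2,3) by simp

lemma transpose_image_involutory: "(`) (swap i j) ` (`) (swap i j) ` \<pi> = \<pi>"
  by (simp add: image_image)

lemma transpose_image_block_mem: "{i, j} \<in> (`) (swap i j) ` \<pi> \<longleftrightarrow> {i, j} \<in> \<pi>"
proof -
  have "swap i j ` {i, j} = {i, j}" by auto
  then show ?thesis by (metis imageI transpose_image_involutory)
qed

section \<open>The signed sum over all pair partitions\<close>

lemma insert_pair_partition:
  assumes "a \<in> I" "b \<in> I" "a \<noteq> b"
  shows "bij_betw (insert {a, b}) (pair_partitions (I - {a, b})) {\<pi> \<in> pair_partitions I. {a, b} \<in> \<pi>}"
proof (rule bij_betw_byWitness[where f' = "\<lambda>\<pi>. \<pi> - {{a, b}}"])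
  show "\<forall>\<pi>\<in>pair_partitions (I - {a, b}). insert {a, b} \<pi> - {{a, b}} = \<pi>"
    by (auto simp: pair_partitions_def partition_on_def)
  show "\<forall>\<pi>\<in>{\<pi> \<in> pair_partitions I. {a, b} \<in> \<pi>}. insert {a, b} (\<pi> - {{a, b}}) = \<pi>"
    by auto
  show "insert {a, b} ` pair_partitions (I - {a, b}) \<subseteq> {\<pi> \<in> pair_partitions I. {a, b} \<in> \<pi>}"
  proof clarsimp
    fix \<pi> assume "\<pi> \<in> pair_partitions (I - {a, b})"
    then show "insert {a, b} \<pi> \<in> pair_partitions I"
      using assms by (auto simp: pair_partitions_def partition_on_def disjoint_def)
  qed
  show "(\<lambda>\<pi>. \<pi> - {{a, b}}) ` {\<pi> \<in> pair_partitions I. {a, b} \<in> \<pi>} \<subseteq> pair_partitions (I - {a, b})"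
  proof clarsimp
    fix \<pi> assume \<pi>: "\<pi> \<in> pair_partitions I" "{a, b} \<in> \<pi>"
    have "c \<inter> {a, b} = {}" if "c \<in> \<pi> - {{a, b}}" for c
      using pair_partitions_same_block[OF \<pi>(1) _ \<pi>(2)] that by blast
    moreover have "\<Union> \<pi> = I" using \<pi> by (simp add: pair_partitions_def partition_on_def)
    ultimately have "\<Union> (\<pi> - {{a, b}}) = I - {a, b}" by blast
    then show "\<pi> - {{a, b}} \<in> pair_partitions (I - {a, b})"
      using \<pi> by (auto simp: pair_partitions_def partition_on_def disjoint_def)
  qed
qed

text \<open>A block lying entirely below all other blocks interlaces with none of them.\<close>

lemma crossings_insert_smallest_pair:
  fixes a b :: "'i::linorder"
  assumes "\<pi> \<in> pair_partitions I" "a < b" "\<And>m. m \<in> I \<Longrightarrow> b < m"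
  shows "crossings (insert {a, b} \<pi>) = crossings \<pi>"
proof -
  have c: "b < Min c" "b < Max c" if "c \<in> \<pi>" for c
    using assms(3) by (rule_tac [!] pair_partition_blockE[OF assms(1) that]) auto
  have ab: "Min {a, b} = a" "Max {a, b} = b" using assms(2) by auto
  define cr where "cr = (\<lambda>c c'. Min c < Min c' \<and> Min c' < Max c \<and> Max c < (Max c' :: 'i))"
  have "\<not> cr {a, b} {a, b}" "\<not> cr {a, b} c" "\<not> cr c {a, b}" if "c \<in> \<pi>" for c
    using c[OF that] assms(2) unfolding cr_def ab by auto
  then have "{(c, c'). c \<in> insert {a, b} \<pi> \<and> c' \<in> insert {a, b} \<pi> \<and> cr c c'}
    = {(c, c'). c \<in> \<pi> \<and> c' \<in> \<pi> \<and> cr c c'}"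
    unfolding cr_def by blast
  then show ?thesis by (simp add: crossings_def cr_def)
qed

text \<open>Let \<open>a < b\<close> be the two smallest elements. Partitions that separate them
  cancel under the exchange of \<open>a\<close> and \<open>b\<close>; those containing the block
  \<open>{a, b}\<close> correspond, with the same sign, to the partitions of the remaining set, and
  induction applies.\<close>

lemma sum_crossing_signs:
  fixes I :: "'i::linorder set"
  assumes "finite I" "even (card I)"
  shows "(\<Sum>\<pi>\<in>pair_partitions I. (-1::real) ^ crossings \<pi>) = 1"
  using assms
proof (induction "card I" arbitrary: I rule: less_induct)
  case less
  show ?case
  proof (cases "I = {}")
    case True
    then have "pair_partitions I = {{}}"
      by (auto simp: pair_partitions_def partition_on_def)
    then show ?thesis by (simp add: crossings_def)
  next
    case False
    define a where "a = Min I"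
    have a: "a \<in> I" using less False by (simp add: a_def)
    have "I - {a} \<noteq> {}"
    proof
      assume "I - {a} = {}"
      then have "I = {a}" using a by auto
      with less show False by simp
    qed
    define b where "b = Min (I - {a})"
    have b: "b \<in> I - {a}" using less \<open>I - {a} \<noteq> {}\<close> unfolding b_def by (intro Min_in) auto
    have b_le: "b \<le> m" if "m \<in> I - {a}" for m using less that by (simp add: b_def)
    have ab: "a < b" using less.prems(1) b Min_le[of I b] by (auto simp: a_def less_le)
    have b_gt: "b < m" if "m \<in> I - {a, b}" for m using b_le[of m] that by (auto simp: less_le)
    let ?s = "\<lambda>\<pi>. (-1::real) ^ crossings \<pi>"
    let ?Q = "{\<pi> \<in> pair_partitions I. {a, b} \<in> \<pi>}"
    have "sum ?s (pair_partitions I) = sum ?s ?Q + sum ?s (pair_partitions I - ?Q)"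
      using sum.subset_diff[of ?Q "pair_partitions I" ?s] finite_pair_partitions[OF \<open>finite I\<close>]
      by (simp add: add.commute)
    also have "sum ?s (pair_partitions I - ?Q) = 0"
    proof (rule sum_eq_0_sign_reversing[where \<tau> = "\<lambda>\<pi>. (`) (swap a b) ` \<pi>"])
      fix \<pi> assume "\<pi> \<in> pair_partitions I - ?Q"
      then have \<pi>: "\<pi> \<in> pair_partitions I" "{a, b} \<notin> \<pi>" by auto
      show "(`) (swap a b) ` \<pi> \<in> pair_partitions I - ?Q"
        using transpose_pair_partition[OF \<pi>(1) a, of b] b \<pi>(2) transpose_image_block_mem[of a b \<pi>] by blast
      show "?s ((`) (swap a b) ` \<pi>) = - ?s \<pi>"
        using crossings_transpose[OF \<open>finite I\<close> \<pi>(1) a _ ab _ \<pi>(2)] b b_le by force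
    qed (rule transpose_image_involutory)
    also have "sum ?s ?Q = (\<Sum>\<pi>\<in>pair_partitions (I - {a, b}). ?s (insert {a, b} \<pi>))"
      using insert_pair_partition[of a I b] a b by (intro sum.reindex_bij_betw[symmetric]) auto
    also have "\<dots> = (\<Sum>\<pi>\<in>pair_partitions (I - {a, b}). ?s \<pi>)"
      using ab b_gt by (intro sum.cong refl arg_cong[where f = "\<lambda>n. (-1) ^ n"] crossings_insert_smallest_pair)
    also have "\<dots> = 1"
    proof (rule less.hyps)
      have c: "card (I - {a, b}) = card I - 2" using a b by (subst card_Diff_subset) auto
      have "0 < card I" using less a by (auto simp: card_gt_0_iff)
      then show "card (I - {a, b}) < card I" using c by simp
      show "even (card (I - {a, b}))" using c less by simp
    qed (use less in simp)
    finally show ?thesis by simp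
  qed
qed

text \<open>This is the alternating sum 1 - 1 + 1 - ... with one term per element. Adding a new
  maximum leaves the ranks of the old elements unchanged.\<close>

lemma sum_rank_signs:
  fixes I :: "'i::linorder set"
  assumes "finite I"
  shows "(\<Sum>l\<in>I. (-1::real) ^ card {m\<in>I. m < l}) = of_bool (odd (card I))"
  using assms
proof (induction rule: finite_linorder_max_induct)
  case (insert b A)
  have "b \<notin> A" using insert by auto
  have "{m \<in> insert b A. m < b} = A" using insert by auto
  moreover have "{m \<in> insert b A. m < l} = {m \<in> A. m < l}" if "l \<in> A" for l
    using insert that by auto
  ultimately have "(\<Sum>l\<in>insert b A. (-1::real) ^ card {m\<in>insert b A. m < l}) = (-1) ^ card A + of_bool (odd (card A))"
    using insert \<open>b \<notin> A\<close> by simp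
  then show ?case using insert \<open>b \<notin> A\<close> by auto
qed simp

section \<open>Partitions into pairs and at most one singleton\<close>

text \<open>
  A pair \<open>(L, \<pi>)\<close> stands for the partition with blocks \<open>\<pi>\<close> and a singleton for each element of \<open>L\<close>; the
  parity of \<open>k\<close> decides whether \<open>L\<close> has no or one element, so that both cases are treated at once.
\<close>

definition configs :: "('i::{finite,linorder} set \<times> 'i set set) set" where
  "configs = (SIGMA L:{L. card L = CARD('i) mod 2}. pair_partitions (- L))"

text \<open>\<open>card {..<l}\<close> is l - 1 when the indices are numbered from 1. Without a
  singleton the first product is empty.\<close>

definition config_sign :: "('i::{finite,linorder}) set \<times> 'i set set \<Rightarrow> real" where
  "config_sign \<theta> = (\<Prod>l\<in>fst \<theta>. (-1) ^ card {..<l}) * (-1) ^ crossings (snd \<theta>)"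

definition config_blocks :: "('i::{finite,linorder}) set \<times> 'i set set \<Rightarrow> 'i set set" where
  "config_blocks \<theta> = snd \<theta> \<union> (\<lambda>l. {l}) ` fst \<theta>"

text \<open>The test \<open>Min b = Max b\<close> recognises singletons, so that the factors of both
  kinds form one family of open sets. In a pair the larger index carries the lower coordinate. Only
  coordinates in \<open>b\<close> enter, which is what independence will use.\<close>

definition block_region :: "'i set \<Rightarrow> (real ^ 'i::{finite,linorder}) set" where
  "block_region b = {v. 0 < v $ Max b \<and>
    (if Min b = Max b then v $ Max b < 1 else v $ Max b < v $ Min b \<and> v $ Min b < 1 - v $ Max b)}"

definition config_region :: "'i set \<times> 'i set set \<Rightarrow> (real ^ 'i::{finite,linorder}) set" where
  "config_region \<theta> = {v. \<forall>b\<in>config_blocks \<theta>. v \<in> block_region b}"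

definition swap_config ::
  "'i \<Rightarrow> 'i \<Rightarrow> ('i::{finite,linorder}) set \<times> 'i set set \<Rightarrow> 'i set \<times> 'i set set" where
  "swap_config i j \<theta> = (swap i j ` fst \<theta>, (`) (swap i j) ` snd \<theta>)"

lemma finite_configs: "finite configs"
  unfolding configs_def by (intro finite_SigmaI finite_pair_partitions) auto

lemma sum_configs:
  fixes h :: "('i::{finite,linorder}) set \<times> 'i set set \<Rightarrow> real"
  shows "(\<Sum>\<theta>\<in>configs. config_sign \<theta> * h \<theta>) =
    (if even CARD('i) then \<Sum>\<pi>\<in>pair_partitions UNIV. (-1) ^ crossings \<pi> * h ({}, \<pi>)
     else \<Sum>l\<in>UNIV. (-1) ^ card {..<l} *
       (\<Sum>\<pi>\<in>pair_partitions (UNIV - {l}). (-1) ^ crossings \<pi> * h ({l}, \<pi>)))"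
proof -
  let ?Ls = "{L::'i set. card L = CARD('i) mod 2}"
  let ?g = "\<lambda>L. (\<Prod>l\<in>L. (-1) ^ card {..<l}) *
    (\<Sum>\<pi>\<in>pair_partitions (- L). (-1) ^ crossings \<pi> * h (L, \<pi>))"
  have "(\<Sum>\<theta>\<in>configs. config_sign \<theta> * h \<theta>) =
    (\<Sum>L\<in>?Ls. \<Sum>\<pi>\<in>pair_partitions (- L). config_sign (L, \<pi>) * h (L, \<pi>))"
    unfolding configs_def by (subst sum.Sigma) (auto intro: finite_pair_partitions)
  also have "\<dots> = (\<Sum>L\<in>?Ls. ?g L)"
    by (simp add: config_sign_def sum_distrib_left mult.assoc)
  also have "\<dots> = (if even CARD('i) then ?g {} else \<Sum>l\<in>UNIV. ?g {l})"
  proof (cases "even CARD('i)")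
    case True
    then have "?Ls = {{}}" by auto
    then show ?thesis using True by simp
  next
    case False
    then have "?Ls = (\<lambda>l. {l}) ` UNIV" by (auto simp: card_1_singleton_iff odd_iff_mod_2_eq_one)
    then have "(\<Sum>L\<in>?Ls. ?g L) = (\<Sum>l\<in>UNIV. ?g {l})"
      by (subst \<open>?Ls = _\<close>, subst sum.reindex) (auto simp: inj_on_def)
    then show ?thesis using False by simp
  qed
  finally show ?thesis by (simp add: Compl_eq_Diff_UNIV)
qed

text \<open>For an odd number of indices each choice of the singleton leaves an inner sum equal to
  1, and an alternating sum of odd length remains.\<close>

lemma sum_config_sign: "(\<Sum>\<theta>\<in>(configs :: ('i::{finite,linorder} set \<times> 'i set set) set). config_sign \<theta>) = 1"
proof -
  have "(\<Sum>\<theta>\<in>(configs :: ('i set \<times> 'i set set) set). config_sign \<theta>) =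
    (if even CARD('i) then 1 else \<Sum>l\<in>(UNIV::'i set). (-1) ^ card {..<l})"
    using sum_configs[of "\<lambda>_ :: 'i set \<times> 'i set set. 1"]
    by (simp add: sum_crossing_signs card_Diff_singleton)
  moreover have "(\<Sum>l\<in>(UNIV::'i set). (-1::real) ^ card {..<l}) = of_bool (odd CARD('i))"
    using sum_rank_signs[of "UNIV::'i set"] by (simp add: lessThan_def)
  ultimately show ?thesis by simp
qed

section \<open>Exchanging two neighbouring indices in a configuration\<close>

lemma swap_config_involutory: "swap_config i j (swap_config i j \<theta>) = \<theta>"
  by (simp add: swap_config_def image_image)

lemma swap_config_mem:
  assumes "\<theta> \<in> configs"
  shows "swap_config i j \<theta> \<in> configs"
proof -
  have b: "bij (swap i j)" by simp
  obtain L \<pi> where \<theta>: "\<theta> = (L, \<pi>)" "card L = CARD('a) mod 2" "\<pi> \<in> pair_partitions (- L)"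
    using assms by (auto simp: configs_def)
  have "swap i j ` (- L) = - swap i j ` L"
    using b by (rule bij_image_Compl_eq)
  moreover have "card (swap i j ` L) = card L"
    by (rule card_image[OF inj_on_transpose])
  ultimately show ?thesis
    using image_pair_partition[OF \<theta>(3), of "swap i j"] \<theta>
    by (auto simp: swap_config_def configs_def)
qed

text \<open>If both indices are paired, the parity of the crossings flips. If one of them is the
  singleton, the crossings persist, but the singleton moves by one place and its rank sign flips.
  Both cannot be singletons, as there is at most one.\<close>

lemma config_sign_swap:
  fixes i j :: "'i::{finite,linorder}"
  assumes \<theta>: "\<theta> \<in> configs" and ij: "i < j" and adj: "\<And>m. \<not> (i < m \<and> m < j)"
    and nb: "{i, j} \<notin> snd \<theta>"
  shows "config_sign (swap_config i j \<theta>) = - config_sign \<theta>"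
proof -
  obtain L \<pi> where L: "\<theta> = (L, \<pi>)" "card L = CARD('i) mod 2" "\<pi> \<in> pair_partitions (- L)"
    using \<theta> by (auto simp: configs_def)
  have mono: "strict_mono_on (- L) (swap i j)" if "i \<in> L \<or> j \<in> L"
    using that adj ij by (intro strict_mono_onI transpose_less_transpose[where I = UNIV]) auto
  have rank: "{..<j} = insert i {..<i}"
  proof (rule set_eqI)
    show "m \<in> {..<j} \<longleftrightarrow> m \<in> insert i {..<i}" for m
      using adj[of m] ij by auto
  qed
  have card_j: "card {..<j} = Suc (card {..<i})"
    unfolding rank by simp
  consider "i \<notin> L" "j \<notin> L" | l where "L = {l}" "l = i \<or> l = j"
  proof (cases "L = {}")
    case False
    then have "card L \<noteq> 0" by simp
    then have "card L = 1" using L(2) by simp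
    then obtain l where "L = {l}" by (auto simp: card_1_singleton_iff)
    then show thesis using that by blast
  qed (use that in blast)
  then show ?thesis
  proof cases
    case 1
    have "swap i j ` L = L"
      using 1 by (force simp: Transposition.transpose_def image_iff)
    moreover have "(-1::real) ^ crossings ((`) (swap i j) ` \<pi>) = - ((-1) ^ crossings \<pi>)"
      using 1 nb adj L by (intro crossings_transpose[OF _ L(3) _ _ ij]) auto
    ultimately show ?thesis
      using L by (simp add: config_sign_def swap_config_def)
  next
    case 2
    have "crossings ((`) (swap i j) ` \<pi>) = crossings \<pi>"
      using 2 by (intro crossings_image_strict_mono[OF L(3)] mono) auto
    then show ?thesis
      using 2 L card_j by (auto simp: config_sign_def swap_config_def)
  qed
qed

lemma config_blockE:
  assumes "\<theta> \<in> configs" "b \<in> config_blocks \<theta>"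
  obtains u where "b = {u}" | u v where "b \<in> snd \<theta>" "b = {u, v}" "u < v"
proof -
  have \<pi>: "snd \<theta> \<in> pair_partitions (- fst \<theta>)"
    using assms(1) by (auto simp: configs_def)
  show thesis
  proof (cases "b \<in> snd \<theta>")
    case True
    then show thesis using pair_partition_blockE[OF \<pi> True] that(2) by metis
  next
    case False
    then show thesis using assms(2) that(1) by (auto simp: config_blocks_def)
  qed
qed

lemma config_blocks_cover:
  assumes "\<theta> \<in> configs"
  obtains b where "b \<in> config_blocks \<theta>" "m \<in> b"
proof -
  have "\<Union> (snd \<theta>) = - fst \<theta>"
    using assms by (auto simp: configs_def pair_partitions_def partition_on_def)
  then have "m \<in> \<Union> (config_blocks \<theta>)"
    by (cases "m \<in> fst \<theta>") (auto simp: config_blocks_def)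
  then show thesis using that by blast
qed

section \<open>Block conditions, the alcove and its walls\<close>

lemma block_region_singleton: "v \<in> block_region {u} \<longleftrightarrow> 0 < v $ u \<and> v $ u < 1"
  by (simp add: block_region_def)

lemma block_region_pair:
  "p < q \<Longrightarrow> v \<in> block_region {p, q} \<longleftrightarrow> 0 < v $ q \<and> v $ q < v $ p \<and> v $ p < 1 - v $ q"
  by (auto simp: block_region_def)

text \<open>The blocks cover all indices, and each block condition bounds its lowest coordinate from
  below by 0. Consequently a point with a vanishing coordinate lies in no region, which settles the
  wall x_k = 0.\<close>

lemma config_region_pos:
  assumes "\<theta> \<in> configs" "v \<in> config_region \<theta>"
  shows "0 < v $ m"
proof -
  obtain b where b: "b \<in> config_blocks \<theta>" "m \<in> b"
    using config_blocks_cover[OF assms(1)] .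
  then have "v \<in> block_region b" using assms(2) by (simp add: config_region_def)
  with b show ?thesis
    by (auto elim!: config_blockE[OF assms(1)] simp: block_region_singleton block_region_pair)
qed

text \<open>The map \<open>r\<close> is kept abstract so that the reflections in x_i = x_(i+1) and
  in x_1 + x_2 = 1 share the argument. Compatibility is asked only for pairs whose order survives
  the exchange, because \<open>block_region\<close> assigns different roles to the smaller and the
  larger index; by adjacency this covers every block other than \<open>{i, j}\<close>.\<close>

lemma config_region_swap:
  fixes i j :: "'i::{finite,linorder}"
  assumes \<theta>: "\<theta> \<in> configs" and ij: "i < j" and adj: "\<And>m. \<not> (i < m \<and> m < j)"
    and nb: "{i, j} \<notin> snd \<theta>"
    and r1: "\<And>u. v \<in> block_region {swap i j u} \<longleftrightarrow> r v \<in> block_region {u}"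
    and r2: "\<And>p q. p < q \<Longrightarrow> swap i j p < swap i j q \<Longrightarrow> {p, q} \<noteq> {i, j} \<Longrightarrow>
      v \<in> block_region {swap i j p, swap i j q} \<longleftrightarrow> r v \<in> block_region {p, q}"
  shows "v \<in> config_region (swap_config i j \<theta>) \<longleftrightarrow> r v \<in> config_region \<theta>"
proof -
  have "config_blocks (swap_config i j \<theta>) = (`) (swap i j) ` config_blocks \<theta>"
    by (simp add: config_blocks_def swap_config_def image_Un image_image)
  moreover have "v \<in> block_region (swap i j ` b) \<longleftrightarrow> r v \<in> block_region b"
    if b: "b \<in> config_blocks \<theta>" for b
    using config_blockE[OF \<theta> b]
  proof cases
    case (1 u)
    then show ?thesis using r1 by simp
  next
    case (2 p q)
    have ne: "{p, q} \<noteq> {i, j}" using 2 nb by metis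
    have "swap i j p < swap i j q"
      using 2 ne by (intro transpose_less_transpose[where I = UNIV, OF ij]) (use adj in auto)
    then show ?thesis using r2[OF 2(3) _ ne] 2 by simp
  qed
  ultimately show ?thesis by (simp add: config_region_def)
qed

lemma index_facts:
  assumes "CARD('i::{finite,linorder}) \<ge> 2"
  shows "(index1::'i) < index2" "\<And>m::'i. index1 \<le> m" "\<And>m::'i. m \<noteq> index1 \<Longrightarrow> index2 \<le> m"
proof -
  have ne: "UNIV - {index1::'i} \<noteq> {}"
  proof
    assume "UNIV - {index1::'i} = {}"
    then have "(UNIV::'i set) = {index1}" by auto
    then have "CARD('i) = card {index1::'i}" by (rule arg_cong)
    with assms show False by simp
  qed
  show le: "index1 \<le> m" for m :: 'i by (simp add: index1_def)
  show "index2 \<le> m" if "m \<noteq> index1" for m :: 'i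
    using that unfolding index2_def by (intro Min_le) auto
  have "index2 \<in> UNIV - {index1::'i}"
    unfolding index2_def using ne by (intro Min_in) auto
  then show "(index1::'i) < index2" using le[of index2] by (auto simp: less_le)
qed

text \<open>Coordinates decrease in the alcove, so every sum of two of them is at most x_1 + x_2 <
  1; since x_2 > 0, each single coordinate is below 1 as well.\<close>

lemma alcove_subset_config_region:
  assumes card: "CARD('i::{finite,linorder}) \<ge> 2" and \<theta>: "\<theta> \<in> configs"
  shows "(alcove_B :: (real ^ 'i::{finite,linorder}) set) \<subseteq> config_region \<theta>"
proof
  fix v :: "real ^ 'i::{finite,linorder}" assume v: "v \<in> alcove_B"
  note idx = index_facts[OF card]
  have anti: "v $ q \<le> v $ p" if "p \<le> q" for p q
    using v that by (cases "p = q") (auto simp: alcove_B_def less_le intro: less_imp_le)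
  have pos: "0 < v $ p" for p using v by (simp add: alcove_B_def)
  have "v $ p + v $ q < 1" if "p < q" for p q
  proof -
    have "index2 \<le> q" using idx that by (metis not_less)
    then have "v $ p + v $ q \<le> v $ index1 + v $ index2"
      using idx by (intro add_mono anti) auto
    then show ?thesis using v by (simp add: alcove_B_def)
  qed
  moreover have "v $ p < 1" for p
    using anti[OF idx(2), of p] pos[of index2] v unfolding alcove_B_def by (smt (verit) mem_Collect_eq)
  moreover have "v $ q < v $ p" if "p < q" for p q using v that by (simp add: alcove_B_def)
  ultimately have "v \<in> block_region b" if "b \<in> config_blocks \<theta>" for b
    using pos by (rule_tac config_blockE[OF \<theta> that])
      (auto simp: block_region_singleton block_region_pair less_diff_eq)
  then show "v \<in> config_region \<theta>" by (simp add: config_region_def)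
qed

text \<open>A boundary point may lie on several walls; any one of them will do. Only configurations
  whose region contains \<open>y\<close> are considered: this excludes the block
  \<open>{i, j}\<close>, whose condition fails on the wall, and so makes the sign change
  available.\<close>

lemma wall_reflection:
  fixes y :: "real ^ 'i::{finite,linorder}"
  assumes card: "CARD('i) \<ge> 2" and y: "y \<notin> alcove_B"
    and y1: "\<And>p q. p < q \<Longrightarrow> y $ q \<le> y $ p" and y2: "\<And>p. 0 \<le> y $ p"
    and y3: "y $ index1 + y $ index2 \<le> 1"
  obtains r \<tau> where "r \<in> affine_weyl_B" "r y = y"
    "\<And>\<theta>. \<theta> \<in> configs \<Longrightarrow> y \<in> config_region \<theta> \<Longrightarrow> \<tau> \<theta> \<in> configs \<and> \<tau> (\<tau> \<theta>) = \<theta> \<and>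
      config_sign (\<tau> \<theta>) = - config_sign \<theta> \<and> (\<forall>v. v \<in> config_region (\<tau> \<theta>) \<longleftrightarrow> r v \<in> config_region \<theta>)"
proof -
  note idx = index_facts[OF card]
  note result = that
  have wall: thesis
    if r: "r \<in> affine_weyl_B" "r y = y" and ij: "i < j" "\<And>m. \<not> (i < m \<and> m < j)"
      and nb: "y \<notin> block_region {i, j}"
      and r1: "\<And>u v. v \<in> block_region {swap i j u} \<longleftrightarrow> r v \<in> block_region {u}"
      and r2: "\<And>p q v. p < q \<Longrightarrow> swap i j p < swap i j q \<Longrightarrow> {p, q} \<noteq> {i, j} \<Longrightarrow>
        v \<in> block_region {swap i j p, swap i j q} \<longleftrightarrow> r v \<in> block_region {p, q}" for r i j
  proof (rule result[OF r, of "swap_config i j"])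
    fix \<theta> :: "'i set \<times> 'i set set" assume \<theta>: "\<theta> \<in> configs" "y \<in> config_region \<theta>"
    then have n: "{i, j} \<notin> snd \<theta>"
      using nb by (auto simp: config_region_def config_blocks_def)
    show "swap_config i j \<theta> \<in> configs \<and> swap_config i j (swap_config i j \<theta>) = \<theta> \<and>
      config_sign (swap_config i j \<theta>) = - config_sign \<theta> \<and>
      (\<forall>v. v \<in> config_region (swap_config i j \<theta>) \<longleftrightarrow> r v \<in> config_region \<theta>)"
      using swap_config_mem[OF \<theta>(1)] swap_config_involutory config_sign_swap[OF \<theta>(1) ij n]
        config_region_swap[where r = r, OF \<theta>(1) ij n r1 r2] by blast
  qed
  consider (zero) p where "y $ p = 0" | (eq) p q where "p < q" "y $ p = y $ q"
    | (top) "y $ index1 + y $ index2 = 1"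
    using y y1 y2 y3 by (fastforce simp: alcove_B_def less_le)
  then show thesis
  proof cases
    case zero
    \<comment> \<open>No configuration region contains \<open>y\<close> here, so identity maps
      satisfy the conclusion vacuously.\<close>
    have "(\<lambda>v. v) \<in> (affine_weyl_B :: (real ^ 'i::{finite,linorder} \<Rightarrow> real ^ 'i::{finite,linorder}) set)"
      unfolding affine_weyl_B_def
      by (intro CollectI exI[of _ id] exI[of _ "\<lambda>_. 1"] exI[of _ 0]) (auto simp: fun_eq_iff vec_eq_iff)
    then show thesis
      using config_region_pos[where v = y and m = p] zero
      by (intro result[of "\<lambda>v. v" "\<lambda>\<theta>. \<theta>"]) (auto dest: less_imp_neq)
  next
    case eq
    \<comment> \<open>The successor of \<open>p\<close>: since the coordinates of \<open>y\<close>
      are weakly decreasing, equality at \<open>p\<close> and \<open>q\<close> forces equality at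
      \<open>p\<close> and \<open>q'\<close>.\<close>
    define q' where "q' = Min {m. p < m}"
    have "q' \<in> {m. p < m}"
      unfolding q'_def by (rule Min_in) (use eq(1) in auto)
    then have q': "p < q'" "q' \<le> q" "\<And>m. p < m \<Longrightarrow> q' \<le> m"
      using eq(1) by (auto simp: q'_def)
    have yq: "y $ p = y $ q'"
      using y1[OF q'(1)] y1[of q' q] q'(2) eq by (cases "q' = q") auto
    let ?r = "\<lambda>v :: real ^ 'i::{finite,linorder}. \<chi> m. v $ swap p q' m"
    have "?r \<in> affine_weyl_B"
      unfolding affine_weyl_B_def
      by (intro CollectI exI[of _ "swap p q'"] exI[of _ "\<lambda>_. 1"] exI[of _ 0]) (auto simp: fun_eq_iff vec_eq_iff)
    moreover have "?r y = y"
      using yq by (auto simp: vec_eq_iff Transposition.transpose_def)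
    ultimately show thesis
    proof (rule wall[OF _ _ q'(1)])
      show "\<not> (p < m \<and> m < q')" for m using q'(3)[of m] by auto
    qed (use yq q'(1) in \<open>auto simp: block_region_singleton block_region_pair\<close>)
  next
    case top
    \<comment> \<open>The translation part of (x_1, x_2) to (1 - x_2, 1 - x_1). Its two entries 1
      have an even sum, so the map belongs to the group.\<close>
    define d :: "int ^ 'i::{finite,linorder}" where "d = (\<chi> m. if m \<in> {index1, index2} then 1 else 0)"
    let ?r = "\<lambda>v :: real ^ 'i::{finite,linorder}. \<chi> m. (if m \<in> {index1, index2} then -1 else 1) *
      v $ swap index1 index2 m + of_int (d $ m)"
    have r: "?r v $ m = (if m \<in> {index1, index2} then 1 - v $ swap index1 index2 m else v $ m)" for v m
      by (auto simp: d_def Transposition.transpose_def)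
    have "(\<Sum>m\<in>UNIV. d $ m) = (\<Sum>m\<in>UNIV. if m \<in> {index1, index2 :: 'i} then 1 else 0)"
      by (simp add: d_def)
    also have "\<dots> = (\<Sum>m\<in>{index1, index2 :: 'i}. 1)"
      by (subst sum.inter_restrict[symmetric]) auto
    also have "\<dots> = 2" using idx(1) by simp
    finally have "even (\<Sum>m\<in>UNIV. d $ m)" by simp
    then have "?r \<in> affine_weyl_B"
      unfolding affine_weyl_B_def
      by (intro CollectI exI[of _ "swap index1 index2"] exI[of _ "\<lambda>m. if m \<in> {index1, index2} then -1 else 1"]
          exI[of _ d]) auto
    moreover have "?r y = y"
      using top idx(1) by (auto simp: vec_eq_iff d_def)
    ultimately show thesis
    proof (rule wall[OF _ _ idx(1)])
      show "\<not> (index1 < m \<and> m < index2)" for m :: 'i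
        using idx(3)[of m] by (cases "m = index1") auto
      show "y \<notin> block_region {index1, index2}"
        using top idx(1) by (auto simp: block_region_pair)
      show "v \<in> block_region {swap index1 index2 u} \<longleftrightarrow> ?r v \<in> block_region {u}" for u v
        unfolding block_region_singleton r by (auto simp: Transposition.transpose_def)
      show "v \<in> block_region {swap index1 index2 p, swap index1 index2 q} \<longleftrightarrow> ?r v \<in> block_region {p, q}"
        if pq: "p < q" "swap index1 index2 p < swap index1 index2 q" "{p, q} \<noteq> {index1, index2}" for p q v
      proof -
        \<comment> \<open>The lower coordinate, with index \<open>q\<close>, is thus left alone by
          the reflection, and at most the upper one is reflected to 1 minus a coordinate. The
          condition \<open>v $ q < v $ p < 1 - v $ q\<close> is invariant under replacing
          \<open>v $ p\<close> by \<open>1 - v $ p\<close>.\<close>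
        have "q \<noteq> index1" using pq(1) idx(2)[of p] by auto
        moreover have "q \<noteq> index2" using pq idx(3)[of p] by (cases "p = index1") auto
        ultimately show ?thesis
          unfolding block_region_pair[OF pq(1)] block_region_pair[OF pq(2)] r
          by (auto simp: Transposition.transpose_def)
      qed
    qed
  qed
qed

section \<open>Staying in an open set\<close>

text \<open>
  Only rational times are inspected, which makes the set measurable in the product sigma-algebra;
  for continuous paths it means staying in \<open>G\<close> on \<open>[0, u]\<close>. This fails for \<open>G = UNIV\<close>, since
  \<open>infdist x {} = 0\<close>.
\<close>

definition stays :: "'v::metric_space set \<Rightarrow> real \<Rightarrow> (real \<Rightarrow> 'v) set" where
  "stays G u = {p \<in> space path_space.
    \<exists>n. \<forall>q\<in>\<rat> \<inter> {0..u}. inverse (real (Suc n)) \<le> infdist (p q) (- G)}"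

lemma countable_Rats_Int: "countable (\<rat> \<inter> A :: real set)"
  by (intro countable_Int1 countable_rat)

lemma measurable_path_component: "0 \<le> q \<Longrightarrow> (\<lambda>p. p q) \<in> path_space \<rightarrow>\<^sub>M borel"
  unfolding path_space_def by (rule measurable_component_singleton) simp

lemma borel_measurable_infdist:
  "f \<in> M \<rightarrow>\<^sub>M borel \<Longrightarrow> (\<lambda>x. infdist (f x :: 'v::metric_space) A) \<in> borel_measurable M"
  by (rule measurable_compose[of f M borel "\<lambda>y. infdist y A"])
    (auto intro!: borel_measurable_continuous_onI continuous_intros)

lemma pred_le_real:
  fixes f g :: "'a \<Rightarrow> real"
  shows "f \<in> borel_measurable M \<Longrightarrow> g \<in> borel_measurable M \<Longrightarrow> Measurable.pred M (\<lambda>x. f x \<le> g x)"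
  unfolding pred_def by (rule borel_measurable_le)

lemma sets_stays: "stays G u \<in> sets path_space"
proof -
  have "Measurable.pred path_space (\<lambda>p. \<exists>n. \<forall>q\<in>\<rat> \<inter> {0..u}. inverse (real (Suc n)) \<le> infdist (p q) (- G))"
    by (intro pred_intros_countable measurable_pred_countable countable_Rats_Int
        pred_le_real borel_measurable_const borel_measurable_infdist measurable_path_component) auto
  then show ?thesis by (simp add: stays_def pred_def)
qed

text \<open>This is the event for the pair (exit time, future path) in which the horizon depends on
  the first component. Quantifying over all nonnegative rationals, with the bound on
  \<open>q\<close> as a premise, keeps the countable index set independent of the point.\<close>

lemma sets_stays_remaining:
  "{z \<in> space (borel \<Otimes>\<^sub>M path_space). fst z \<le> ennreal t \<and> snd z \<in> stays G (t - enn2real (fst z))}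
    \<in> sets (borel \<Otimes>\<^sub>M path_space)"
proof -
  have "Measurable.pred (borel \<Otimes>\<^sub>M path_space) (\<lambda>z. \<exists>n. \<forall>q\<in>\<rat> \<inter> {0..}.
    q \<le> t - enn2real (fst z) \<longrightarrow> inverse (real (Suc n)) \<le> infdist (snd z q) (- G))"
    by (intro pred_intros_countable measurable_pred_countable countable_Rats_Int pred_intros_logic
        pred_le_real borel_measurable_const borel_measurable_infdist
        measurable_compose[OF measurable_snd measurable_path_component]) auto
  moreover have "Measurable.pred (borel \<Otimes>\<^sub>M path_space) (\<lambda>z. fst z \<le> ennreal t)"
    by measurable
  ultimately have "Measurable.pred (borel \<Otimes>\<^sub>M path_space) (\<lambda>z. fst z \<le> ennreal t \<and>
     (\<exists>n. \<forall>q\<in>\<rat> \<inter> {0..}. q \<le> t - enn2real (fst z) \<longrightarrow> inverse (real (Suc n)) \<le> infdist (snd z q) (- G)))"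
    by (intro pred_intros_logic)
  moreover have "(\<forall>q\<in>\<rat> \<inter> {0..}. q \<le> r \<longrightarrow> Q q) \<longleftrightarrow> (\<forall>q\<in>\<rat> \<inter> {0..r}. Q q)" for r :: real and Q
    by auto
  ultimately have "{z \<in> space (borel \<Otimes>\<^sub>M path_space). fst z \<le> ennreal t \<and>
     (\<exists>n. \<forall>q\<in>\<rat> \<inter> {0..t - enn2real (fst z)}. inverse (real (Suc n)) \<le> infdist (snd z q) (- G))}
     \<in> sets (borel \<Otimes>\<^sub>M path_space)"
    by (simp add: pred_def)
  then show ?thesis
    by (rule back_subst[where P = "\<lambda>A. A \<in> sets (borel \<Otimes>\<^sub>M path_space)"])
      (simp add: stays_def space_pair_measure mem_Times_iff conj_commute conj_left_commute cong: conj_cong)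
qed

text \<open>A continuous path that stays in \<open>G\<close> on the compact interval has a positive
  minimal distance to the complement. Conversely, a bound with the same \<open>n\<close> at all
  rational times extends to all times by continuity; pointwise positivity at rational times would
  not.\<close>

lemma stays_iff:
  assumes p: "continuous_on {0..} p" and G: "open G" "G \<noteq> UNIV" and u: "0 \<le> u"
  shows "restrict p {0..} \<in> stays G u \<longleftrightarrow> (\<forall>s\<in>{0..u}. p s \<in> G)"
proof -
  have ne: "- G \<noteq> {}" using G by auto
  define f where "f s = infdist (p s) (- G)" for s
  have f: "continuous_on {0..} f"
    unfolding f_def using p by (intro continuous_intros)
  have pos: "0 < f s \<longleftrightarrow> p s \<in> G" for s
    using in_closed_iff_infdist_zero[of "- G" "p s"] G ne infdist_nonneg[of "p s" "- G"]
    by (auto simp: f_def less_le closed_def)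
  have mem: "restrict p {0..} \<in> stays G u \<longleftrightarrow> (\<exists>n. \<forall>q\<in>\<rat> \<inter> {0..u}. inverse (real (Suc n)) \<le> f q)"
    by (auto simp: stays_def path_space_def space_PiM f_def)
  show ?thesis
  proof
    assume "restrict p {0..} \<in> stays G u"
    then obtain n where n: "\<And>q. q \<in> \<rat> \<inter> {0..u} \<Longrightarrow> inverse (real (Suc n)) \<le> f q"
      unfolding mem by blast
    show "\<forall>s\<in>{0..u}. p s \<in> G"
    proof
      fix s assume s: "s \<in> {0..u}"
      have "inverse (real (Suc n)) \<le> f s"
      proof (rule ccontr)
        assume "\<not> inverse (real (Suc n)) \<le> f s"
        then have "0 < inverse (real (Suc n)) - f s" by simp
        then obtain d where d: "0 < d" "\<And>s'. 0 \<le> s' \<Longrightarrow> dist s' s < d \<Longrightarrow> dist (f s') (f s) < inverse (real (Suc n)) - f s"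
          using f s unfolding continuous_on_iff by (metis atLeast_iff atLeastAtMost_iff)
        \<comment> \<open>Approximation from the left keeps \<open>q\<close> in the interval; the
          time 0, which has no room to its left, is itself rational.\<close>
        obtain q where q: "q \<in> \<rat> \<inter> {0..u}" "dist q s < d"
        proof (cases "s = 0")
          case True
          then show ?thesis using d u by (intro that[of 0]) auto
        next
          case False
          then have "max 0 (s - d) < s" using s d by auto
          then obtain q where "q \<in> \<rat>" "max 0 (s - d) < q" "q < s"
            using Rats_dense_in_real by blast
          then show ?thesis using s by (intro that[of q]) (auto simp: dist_real_def)
        qed
        then show False using d(2)[of q] n[of q] by (auto simp: dist_real_def)
      qed
      then show "p s \<in> G" unfolding pos[symmetric]
        by (rule less_le_trans[rotated]) simp
    qed
  next
    assume s: "\<forall>s\<in>{0..u}. p s \<in> G"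
    have "continuous_on {0..u} f" by (rule continuous_on_subset[OF f]) auto
    then obtain s0 where s0: "s0 \<in> {0..u}" "\<And>s. s \<in> {0..u} \<Longrightarrow> f s0 \<le> f s"
      using continuous_attains_inf[of "{0..u}" f] u by auto
    then have "0 < f s0" using s pos by auto
    then obtain n where "inverse (real (Suc n)) < f s0" using reals_Archimedean by auto
    then show "restrict p {0..} \<in> stays G u"
      unfolding mem using s0 by (intro exI[of _ n]) force
  qed
qed

section \<open>Exit times as stopping times\<close>

text \<open>
  Paths are only almost surely continuous, so the exit time itself need not be a stopping time of
  the raw filtration. Its modification below looks at rational times and stops looking once the
  path is seen to be discontinuous.
\<close>

definition uc_upto :: "(real \<Rightarrow> 'w \<Rightarrow> 'v::metric_space) \<Rightarrow> 'w \<Rightarrow> real \<Rightarrow> bool" where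
  "uc_upto X \<omega> q \<longleftrightarrow> (\<forall>m. \<exists>l. \<forall>a\<in>\<rat> \<inter> {0..q}. \<forall>b\<in>\<rat> \<inter> {0..q}.
    dist a b < inverse (real (Suc l)) \<longrightarrow> dist (X a \<omega>) (X b \<omega>) < inverse (real (Suc m)))"

text \<open>The exit may happen at an irrational time, so it shows only through rational times at
  which the distance to the complement becomes arbitrarily small. Requiring \<open>uc_upto\<close>
  at \<open>q\<close> rather than at \<open>u\<close> keeps earlier observations valid after a
  discontinuity.\<close>

definition exit_seen :: "(real \<Rightarrow> 'w \<Rightarrow> 'v::metric_space) \<Rightarrow> 'v set \<Rightarrow> 'w \<Rightarrow> real \<Rightarrow> bool" where
  "exit_seen X A \<omega> u \<longleftrightarrow> (\<forall>n. \<exists>q\<in>\<rat> \<inter> {0..u}. uc_upto X \<omega> q \<and> infdist (X q \<omega>) (- A) < inverse (real (Suc n)))"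

definition raw_exit_time :: "(real \<Rightarrow> 'w \<Rightarrow> 'v::metric_space) \<Rightarrow> 'v set \<Rightarrow> 'w \<Rightarrow> ennreal" where
  "raw_exit_time X A \<omega> = Inf (ennreal ` {u. 0 \<le> u \<and> exit_seen X A \<omega> u})"

lemma uc_upto_mono:
  assumes "uc_upto X \<omega> v" "u \<le> v"
  shows "uc_upto X \<omega> u"
proof -
  have "\<rat> \<inter> {0..u} \<subseteq> \<rat> \<inter> {0..v}" using assms(2) by auto
  then show ?thesis
    using assms(1) unfolding uc_upto_def by (meson subsetD)
qed

lemma exit_seen_mono:
  assumes "exit_seen X A \<omega> u" "u \<le> v"
  shows "exit_seen X A \<omega> v"
proof -
  have "\<rat> \<inter> {0..u} \<subseteq> \<rat> \<inter> {0..v}" using assms(2) by auto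
  then show ?thesis
    using assms(1) unfolding exit_seen_def by (meson subsetD)
qed

text \<open>If the path is uniformly continuous on the rationals a little beyond \<open>u\<close>, a
  time just after \<open>u\<close> close to the complement can be moved back to a time up to
  \<open>u\<close> at small cost. Otherwise no time after \<open>u\<close> is inspected at all.
  Without the clause \<open>uc_upto\<close>, a jump immediately after \<open>u\<close> would refute
  the claim.\<close>

lemma exit_seen_right_closed:
  assumes v: "\<And>v. u < v \<Longrightarrow> exit_seen X A \<omega> v" and u: "0 \<le> u"
  shows "exit_seen X A \<omega> u"
proof (rule ccontr)
  assume "\<not> exit_seen X A \<omega> u"
  then obtain n where n: "\<And>q. q \<in> \<rat> \<inter> {0..u} \<Longrightarrow> uc_upto X \<omega> q \<Longrightarrow> inverse (real (Suc n)) \<le> infdist (X q \<omega>) (- A)"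
    unfolding exit_seen_def by (meson not_less)
  \<comment> \<open>One half of the bound is for the distance at \<open>q\<close>, the other for the
    oscillation between \<open>q\<close> and \<open>q'\<close>.\<close>
  let ?c = "inverse (real (Suc n)) / 2"
  have c: "0 < ?c" by simp
  then obtain m where m: "inverse (real (Suc m)) < ?c" using reals_Archimedean by blast
  show False
  proof (cases "\<exists>v>u. uc_upto X \<omega> v")
    case True
    then obtain v where v': "u < v" "uc_upto X \<omega> v" by auto
    then obtain l where l: "\<And>a b. a \<in> \<rat> \<inter> {0..v} \<Longrightarrow> b \<in> \<rat> \<inter> {0..v} \<Longrightarrow> dist a b < inverse (real (Suc l)) \<Longrightarrow>
        dist (X a \<omega>) (X b \<omega>) < inverse (real (Suc m))"
      unfolding uc_upto_def by meson
    let ?d = "inverse (real (Suc l))"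
    have d: "0 < ?d" by simp
    have "exit_seen X A \<omega> (min v (u + ?d / 2))"
      using v' d by (intro v) auto
    then obtain q where q: "q \<in> \<rat>" "0 \<le> q" "q \<le> v" "q \<le> u + ?d / 2" "uc_upto X \<omega> q"
        "infdist (X q \<omega>) (- A) < inverse (real (Suc m))"
      unfolding exit_seen_def by (metis IntD1 IntD2 atLeastAtMost_iff min.bounded_iff)
    obtain q' where q': "q' \<in> \<rat>" "0 \<le> q'" "q' \<le> u" "dist q q' < ?d"
    proof (cases "q \<le> u")
      case True
      then show ?thesis using q d by (intro that[of q]) auto
    next
      case qu: False
      show ?thesis
      proof (cases "u = 0")
        case True
        then show ?thesis using q d qu by (intro that[of 0]) (auto simp: dist_real_def)
      next
        case False
        then have "max 0 (u - ?d / 2) < u" using u d by auto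
        then obtain q' where "q' \<in> \<rat>" "max 0 (u - ?d / 2) < q'" "q' < u"
          using Rats_dense_in_real by blast
        then show ?thesis using q qu by (intro that[of q']) (auto simp: dist_real_def)
      qed
    qed
    have "inverse (real (Suc n)) \<le> infdist (X q' \<omega>) (- A)"
      using n[of q'] q' v' uc_upto_mono[OF v'(2), of q'] by auto
    moreover have "dist (X q' \<omega>) (X q \<omega>) < inverse (real (Suc m))"
      using l[of q' q] q q' v' by (auto simp: dist_commute)
    moreover have "infdist (X q' \<omega>) (- A) \<le> infdist (X q \<omega>) (- A) + dist (X q' \<omega>) (X q \<omega>)"
      by (rule infdist_triangle)
    ultimately show False using q(6) m by linarith
  next
    case False
    have "exit_seen X A \<omega> (u + 1)" by (rule v) simp
    then obtain q where q: "q \<in> \<rat>" "0 \<le> q" "uc_upto X \<omega> q" "infdist (X q \<omega>) (- A) < inverse (real (Suc n))"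
      unfolding exit_seen_def by (metis IntD1 IntD2 atLeastAtMost_iff)
    then have "q \<le> u" using False by (meson not_le)
    then show False using n[of q] q by auto
  qed
qed

text \<open>Right-closedness makes the infimum attained. The event on the left is therefore decided
  by the path up to \<open>u\<close> and belongs to the raw filtration, without passing to right
  limits.\<close>

lemma raw_exit_time_le_iff:
  assumes u: "0 \<le> u"
  shows "raw_exit_time X A \<omega> \<le> ennreal u \<longleftrightarrow> exit_seen X A \<omega> u"
proof
  assume le: "raw_exit_time X A \<omega> \<le> ennreal u"
  show "exit_seen X A \<omega> u"
  proof (rule exit_seen_right_closed[OF _ u])
    fix v assume "u < v"
    then have "raw_exit_time X A \<omega> < ennreal v"
      using le u by (metis ennreal_less_iff le_less_trans)
    then obtain u' where "0 \<le> u'" "exit_seen X A \<omega> u'" "ennreal u' < ennreal v"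
      unfolding raw_exit_time_def Inf_less_iff by auto
    then show "exit_seen X A \<omega> v"
      by (metis exit_seen_mono ennreal_less_iff less_imp_le)
  qed
qed (use u in \<open>auto simp: raw_exit_time_def intro!: Inf_lower\<close>)

lemma measurable_natural_filtration:
  assumes "0 \<le> s" "ennreal s \<le> u"
  shows "X s \<in> natural_filtration M X u \<rightarrow>\<^sub>M borel"
proof (rule measurableI)
  fix B :: "'b set" assume "B \<in> sets borel"
  then have "X s -` B \<inter> space M \<in> sets (natural_filtration M X u)"
    unfolding natural_filtration_def using assms by (subst sets_measure_of) auto
  moreover have "space (natural_filtration M X u) = space M"
    using filtration.space_F[OF filtration_natural_filtration] .
  ultimately show "X s -` B \<inter> space (natural_filtration M X u) \<in> sets (natural_filtration M X u)" by simp
qed simp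

lemma stopping_time_raw_exit_time:
  fixes X :: "real \<Rightarrow> 'w \<Rightarrow> 'v::{metric_space,second_countable_topology}"
  shows "stopping_time (natural_filtration M X) (raw_exit_time X A)"
proof (rule stopping_timeI)
  fix t :: ennreal
  show "Measurable.pred (natural_filtration M X t) (\<lambda>\<omega>. raw_exit_time X A \<omega> \<le> t)"
  proof (cases t)
    case (real u)
    have X: "X q \<in> natural_filtration M X t \<rightarrow>\<^sub>M borel" if "0 \<le> q" "q \<le> u" for q
      using that real by (intro measurable_natural_filtration) auto
    have dist: "Measurable.pred (natural_filtration M X t) (\<lambda>\<omega>. dist (X a \<omega>) (X b \<omega>) < c)"
      if "a \<in> \<rat> \<inter> {0..q}" "b \<in> \<rat> \<inter> {0..q}" "q \<le> u" for a b c q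
      using that by (intro borel_measurable_pred_less borel_measurable_dist X borel_measurable_const) auto
    have uc: "Measurable.pred (natural_filtration M X t) (\<lambda>\<omega>. uc_upto X \<omega> q)" if q: "q \<le> u" for q
      unfolding uc_upto_def
      by (intro pred_intros_countable measurable_pred_countable[OF countable_Rats_Int] pred_intros_imp' dist[OF _ _ q])
    have "Measurable.pred (natural_filtration M X t) (\<lambda>\<omega>. infdist (X q \<omega>) (- A) < c)"
      if "q \<in> \<rat> \<inter> {0..u}" for q c
      using that by (intro borel_measurable_pred_less borel_measurable_infdist X borel_measurable_const) auto
    with uc have "Measurable.pred (natural_filtration M X t) (\<lambda>\<omega>. uc_upto X \<omega> q \<and> infdist (X q \<omega>) (- A) < c)"
      if "q \<in> \<rat> \<inter> {0..u}" for q c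
      using that by (intro pred_intros_logic) auto
    then have "Measurable.pred (natural_filtration M X t) (\<lambda>\<omega>. exit_seen X A \<omega> u)"
      unfolding exit_seen_def
      by (intro pred_intros_countable measurable_pred_countable[OF countable_Rats_Int])
    then show ?thesis using real by (simp add: raw_exit_time_le_iff)
  qed simp
qed

text \<open>Along a continuous path \<open>uc_upto\<close> always holds by compactness, so
  \<open>exit_seen\<close> becomes the negation of \<open>stays\<close>.\<close>

lemma exit_seen_iff:
  assumes p: "continuous_on {0..} (\<lambda>t. X t \<omega>)" and A: "open A" "A \<noteq> UNIV" and u: "0 \<le> u"
  shows "exit_seen X A \<omega> u \<longleftrightarrow> (\<exists>s\<in>{0..u}. X s \<omega> \<notin> A)"
proof -
  have uc: "uc_upto X \<omega> q" for q
    unfolding uc_upto_def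
  proof
    fix m
    have "uniformly_continuous_on {0..q} (\<lambda>t. X t \<omega>)"
      by (intro compact_uniformly_continuous continuous_on_subset[OF p]) auto
    then obtain d where d: "0 < d" "\<And>a b. a \<in> {0..q} \<Longrightarrow> b \<in> {0..q} \<Longrightarrow> dist b a < d \<Longrightarrow>
        dist (X b \<omega>) (X a \<omega>) < inverse (real (Suc m))"
      unfolding uniformly_continuous_on_def by (metis inverse_positive_iff_positive of_nat_0_less_iff zero_less_Suc)
    obtain l where "inverse (real (Suc l)) < d" using reals_Archimedean[OF d(1)] by auto
    then show "\<exists>l. \<forall>a\<in>\<rat> \<inter> {0..q}. \<forall>b\<in>\<rat> \<inter> {0..q}.
        dist a b < inverse (real (Suc l)) \<longrightarrow> dist (X a \<omega>) (X b \<omega>) < inverse (real (Suc m))"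
      using d(2) by (intro exI[of _ l]) (auto intro: less_trans)
  qed
  have "exit_seen X A \<omega> u \<longleftrightarrow> restrict (\<lambda>t. X t \<omega>) {0..} \<notin> stays A u"
    using uc by (auto simp: exit_seen_def stays_def path_space_def space_PiM not_le)
  then show ?thesis
    using stays_iff[OF p A u] by auto
qed

text \<open>Strictness needs \<open>A\<close> open: a continuous path that is in \<open>A\<close> at
  time \<open>u\<close> remains there up to \<open>u + d\<close>, which pushes the infimum beyond
  \<open>u\<close>.\<close>

lemma exit_time_greater_iff:
  fixes X :: "real \<Rightarrow> 'w \<Rightarrow> 'v::metric_space"
  assumes p: "continuous_on {0..} (\<lambda>t. X t \<omega>)" and A: "open A" and u: "0 \<le> u"
  shows "ennreal u < exit_time X A \<omega> \<longleftrightarrow> (\<forall>s\<in>{0..u}. X s \<omega> \<in> A)"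
proof
  assume *: "\<forall>s\<in>{0..u}. X s \<omega> \<in> A"
  then have "X u \<omega> \<in> A" using u by auto
  then obtain e where e: "0 < e" "ball (X u \<omega>) e \<subseteq> A" using A open_contains_ball by blast
  obtain d where d: "0 < d" "\<And>s. 0 \<le> s \<Longrightarrow> dist s u < d \<Longrightarrow> dist (X s \<omega>) (X u \<omega>) < e"
    using p u e unfolding continuous_on_iff by (metis atLeast_iff)
  have "ennreal (u + d) \<le> exit_time X A \<omega>"
    unfolding exit_time_def
  proof (rule Inf_greatest)
    fix z assume "z \<in> ennreal ` {s. 0 \<le> s \<and> X s \<omega> \<notin> A}"
    then obtain s where s: "z = ennreal s" "0 \<le> s" "X s \<omega> \<notin> A" by auto
    have "u < s" using * s by (meson atLeastAtMost_iff not_le)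
    moreover have "\<not> dist s u < d" using d(2)[of s] s e(2) by (auto simp: dist_commute subset_iff)
    ultimately show "ennreal (u + d) \<le> z" using s by (auto simp: dist_real_def intro!: ennreal_leI)
  qed
  moreover have "ennreal u < ennreal (u + d)" using u d by (simp add: ennreal_less_iff)
  ultimately show "ennreal u < exit_time X A \<omega>" by (rule less_le_trans[rotated])
next
  assume *: "ennreal u < exit_time X A \<omega>"
  show "\<forall>s\<in>{0..u}. X s \<omega> \<in> A"
  proof (rule ccontr)
    assume "\<not> ?thesis"
    then obtain s where "0 \<le> s" "s \<le> u" "X s \<omega> \<notin> A" by auto
    then have "exit_time X A \<omega> \<le> ennreal u"
      unfolding exit_time_def by (intro Inf_lower2[of "ennreal s"]) (auto intro: ennreal_leI)
    with * show False by simp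
  qed
qed

lemma raw_exit_time_finite:
  assumes p: "continuous_on {0..} (\<lambda>t. X t \<omega>)" and A: "open A" "A \<noteq> UNIV"
    and fin: "raw_exit_time X A \<omega> < \<infinity>"
  shows "X (enn2real (raw_exit_time X A \<omega>)) \<omega> \<notin> A"
    "\<And>s. 0 \<le> s \<Longrightarrow> s < enn2real (raw_exit_time X A \<omega>) \<Longrightarrow> X s \<omega> \<in> A"
proof -
  define \<tau> where "\<tau> = enn2real (raw_exit_time X A \<omega>)"
  have \<tau>: "raw_exit_time X A \<omega> = ennreal \<tau>" "0 \<le> \<tau>"
    using fin by (auto simp: \<tau>_def)
  have before: "X s \<omega> \<in> A" if "0 \<le> s" "s < \<tau>" for s
  proof (rule ccontr)
    assume "X s \<omega> \<notin> A"
    then have "exit_seen X A \<omega> s" using exit_seen_iff[of X \<omega> A s, OF p A that(1)] that by auto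
    then have "ennreal \<tau> \<le> ennreal s" using raw_exit_time_le_iff[OF that(1), of X A \<omega>] \<tau> by simp
    then show False using that by simp
  qed
  then show "\<And>s. 0 \<le> s \<Longrightarrow> s < enn2real (raw_exit_time X A \<omega>) \<Longrightarrow> X s \<omega> \<in> A"
    by (simp add: \<tau>_def)
  have "exit_seen X A \<omega> \<tau>" using raw_exit_time_le_iff[OF \<tau>(2), of X A \<omega>] \<tau> by simp
  then obtain s where "s \<in> {0..\<tau>}" "X s \<omega> \<notin> A" using exit_seen_iff[of X \<omega> A \<tau>, OF p A \<tau>(2)] by auto
  then show "X (enn2real (raw_exit_time X A \<omega>)) \<omega> \<notin> A"
    using before[of s] by (cases "s = \<tau>") (auto simp: \<tau>_def)
qed

section \<open>The strong Markov property at the exit time\<close>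

lemma measurable_completion_AE:
  assumes f: "f \<in> completion N \<rightarrow>\<^sub>M K" and ae: "AE \<omega> in N. f \<omega> = g \<omega>"
    and g: "\<And>\<omega>. \<omega> \<in> space N \<Longrightarrow> g \<omega> \<in> space K"
  shows "g \<in> completion N \<rightarrow>\<^sub>M K"
proof (rule measurableI)
  fix B assume B: "B \<in> sets K"
  have 1: "Measurable.pred (completion N) (\<lambda>\<omega>. f \<omega> \<in> B)"
    using f B by measurable
  have 2: "Measurable.pred (completion N) (\<lambda>\<omega>. f \<omega> \<noteq> g \<omega>)"
    by (rule sets_completion_AE) (use ae in simp)
  have 3: "Measurable.pred (completion N) (\<lambda>\<omega>. f \<omega> \<noteq> g \<omega> \<and> g \<omega> \<in> B)"
    by (rule sets_completion_AE) (use ae in auto)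
  have "Measurable.pred (completion N) (\<lambda>\<omega>. (a \<omega> \<and> \<not> b \<omega>) \<or> c \<omega>)"
    if "Measurable.pred (completion N) a" "Measurable.pred (completion N) b" "Measurable.pred (completion N) c"
    for a b c using that by measurable
  from this[OF 1 2 3]
  have "Measurable.pred (completion N) (\<lambda>\<omega>. (f \<omega> \<in> B \<and> \<not> f \<omega> \<noteq> g \<omega>) \<or> (f \<omega> \<noteq> g \<omega> \<and> g \<omega> \<in> B))" .
  also have "(\<lambda>\<omega>. (f \<omega> \<in> B \<and> \<not> f \<omega> \<noteq> g \<omega>) \<or> (f \<omega> \<noteq> g \<omega> \<and> g \<omega> \<in> B)) = (\<lambda>\<omega>. g \<omega> \<in> B)"
    by auto
  finally show "g -` B \<inter> space (completion N) \<in> sets (completion N)"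
    by (simp add: pred_def vimage_def Int_def conj_commute)
qed (use g in simp)

lemma pred_completion_AE:
  assumes "Measurable.pred (completion N) Q" "AE \<omega> in N. R \<omega> \<longleftrightarrow> Q \<omega>"
  shows "Measurable.pred (completion N) R"
  by (rule measurable_completion_AE[OF assms(1)]) (use assms(2) in auto)

lemma measure_completion_cong_AE:
  assumes "Measurable.pred (completion N) Q" "AE \<omega> in N. R \<omega> \<longleftrightarrow> Q \<omega>"
  shows "measure (completion N) {\<omega> \<in> space N. R \<omega>} = measure (completion N) {\<omega> \<in> space N. Q \<omega>}"
proof (rule measure_eq_AE)
  show "AE \<omega> in completion N. \<omega> \<in> {\<omega> \<in> space N. R \<omega>} \<longleftrightarrow> \<omega> \<in> {\<omega> \<in> space N. Q \<omega>}"
    using AE_completion[OF assms(2)] by eventually_elim auto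
qed (use assms(1) pred_completion_AE[OF assms] in \<open>auto simp: pred_def\<close>)

locale continuous_strong_markov =
  fixes M :: "'w measure" and P :: "'v::euclidean_space \<Rightarrow> 'w measure" and X :: "real \<Rightarrow> 'w \<Rightarrow> 'v"
  assumes family: "process_family M P X"
    and markov: "strong_markov M P X"
    and cont: "\<And>x. AE \<omega> in P x. continuous_on {0..} (\<lambda>t. X t \<omega>)"
begin

lemma prob_space_P: "prob_space (P x)"
  and sets_P: "sets (P x) = sets M"
  and X_measurable: "0 \<le> t \<Longrightarrow> X t \<in> borel_measurable M"
  and start: "AE \<omega> in P x. X 0 \<omega> = x"
  using family by (auto simp: process_family_def)

lemma space_P: "space (P x) = space M"
  by (rule sets_eq_imp_space_eq[OF sets_P])

lemma prob_space_completion_P: "prob_space (completion (P x))"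
  by (rule prob_space.prob_space_completion[OF prob_space_P])

lemma X_measurable_P: "0 \<le> t \<Longrightarrow> X t \<in> borel_measurable (P x)"
  using X_measurable sets_P by (simp cong: measurable_cong_sets)

lemma path_measurable: "path X \<in> P x \<rightarrow>\<^sub>M path_space"
  unfolding path_def path_space_def by (rule measurable_restrict) (simp add: X_measurable_P)

lemma measurable_process_law: "process_law P X \<in> borel \<rightarrow>\<^sub>M prob_algebra path_space"
  using markov by (simp add: strong_markov_def)

lemma prob_space_process_law: "prob_space (process_law P X y)"
  unfolding process_law_def by (rule prob_space.prob_space_distr[OF prob_space_P path_measurable])

lemma sets_process_law: "sets (process_law P X y) = sets path_space"
  by (simp add: process_law_def)

lemma pred_completion_stays:
  assumes G: "open G" "G \<noteq> UNIV" and u: "0 \<le> u"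
  shows "Measurable.pred (completion (P y)) (\<lambda>\<omega>. \<forall>s\<in>{0..u}. X s \<omega> \<in> G)"
    "cprob P y (\<lambda>\<omega>. \<forall>s\<in>{0..u}. X s \<omega> \<in> G) = measure (process_law P X y) (stays G u)"
    "cprob P y (\<lambda>\<omega>. \<forall>s\<in>{0..u}. X s \<omega> \<in> G) = measure (P y) (path X -` stays G u \<inter> space (P y))"
proof -
  have pred: "Measurable.pred (P y) (\<lambda>\<omega>. path X \<omega> \<in> stays G u)"
    using measurable_sets[OF path_measurable sets_stays, of G u y]
    by (simp add: pred_def vimage_def Int_def conj_commute)
  then have pred': "Measurable.pred (completion (P y)) (\<lambda>\<omega>. path X \<omega> \<in> stays G u)"
    by (rule measurable_completion)
  have ae: "AE \<omega> in P y. (\<forall>s\<in>{0..u}. X s \<omega> \<in> G) \<longleftrightarrow> path X \<omega> \<in> stays G u"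
    using cont by eventually_elim (simp add: path_def stays_iff[OF _ G u])
  show "Measurable.pred (completion (P y)) (\<lambda>\<omega>. \<forall>s\<in>{0..u}. X s \<omega> \<in> G)"
    by (rule pred_completion_AE[OF pred' ae])
  have "cprob P y (\<lambda>\<omega>. \<forall>s\<in>{0..u}. X s \<omega> \<in> G) = measure (completion (P y)) {\<omega> \<in> space (P y). path X \<omega> \<in> stays G u}"
    unfolding cprob_def by (rule measure_completion_cong_AE[OF pred' ae])
  also have "\<dots> = measure (P y) {\<omega> \<in> space (P y). path X \<omega> \<in> stays G u}"
    using pred by (intro measure_completion) (simp add: pred_def)
  also have "{\<omega> \<in> space (P y). path X \<omega> \<in> stays G u} = path X -` stays G u \<inter> space (P y)" by auto
  finally show *: "cprob P y (\<lambda>\<omega>. \<forall>s\<in>{0..u}. X s \<omega> \<in> G) = measure (P y) (path X -` stays G u \<inter> space (P y))" .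
  then show "cprob P y (\<lambda>\<omega>. \<forall>s\<in>{0..u}. X s \<omega> \<in> G) = measure (process_law P X y) (stays G u)"
    unfolding process_law_def by (simp add: measure_distr[OF path_measurable sets_stays])
qed

text \<open>Joint measurability in time and path is not among the assumptions. Rounding
  \<open>R\<close> up to a grid leaves countably many times, and along continuous paths the values
  at the rounded times converge to the value at \<open>R\<close>. The limit is measurable and agrees
  almost surely, hence measurability for the completion.\<close>

lemma measurable_at_random_time:
  assumes R: "R \<in> borel_measurable M" "\<And>\<omega>. 0 \<le> R \<omega>"
  shows "(\<lambda>\<omega>. X (R \<omega>) \<omega>) \<in> completion (P x) \<rightarrow>\<^sub>M borel"
proof -
  \<comment> \<open>\<open>d n r\<close> is \<open>r\<close> rounded up to a multiple of
    \<open>1 / (n + 1)\<close>.\<close>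
  define d where "d n r = real (nat \<lceil>real (Suc n) * r\<rceil>) / real (Suc n)" for n r
  have d_close: "r \<le> d n r \<and> d n r \<le> r + inverse (real (Suc n))" if "0 \<le> r" for n r
  proof -
    have "real (nat \<lceil>real (Suc n) * r\<rceil>) = of_int \<lceil>real (Suc n) * r\<rceil>"
      using that by (simp del: of_nat_Suc)
    then have "real (Suc n) * r \<le> real (nat \<lceil>real (Suc n) * r\<rceil>)"
      "real (nat \<lceil>real (Suc n) * r\<rceil>) \<le> real (Suc n) * r + 1"
      using of_int_ceiling_le_add_one[of "real (Suc n) * r"] le_of_int_ceiling[of "real (Suc n) * r"]
      by (simp_all only:)
    then show ?thesis
      unfolding d_def by (simp add: field_simps del: of_nat_Suc)
  qed
  have d_lim: "(\<lambda>n. d n r) \<longlonglongrightarrow> r" if "0 \<le> r" for r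
  proof (rule tendsto_sandwich[of "\<lambda>_. r"])
    show "(\<lambda>n. r + inverse (real (Suc n))) \<longlonglongrightarrow> r"
      using tendsto_add[OF tendsto_const LIMSEQ_inverse_real_of_nat, of r] by simp
  qed (use d_close[OF that] in auto)
  have meas: "(\<lambda>\<omega>. X (d n (R \<omega>)) \<omega>) \<in> borel_measurable M" for n
    unfolding d_def
    by (rule measurable_compose_countable[where f = "\<lambda>k \<omega>. X (real k / real (Suc n)) \<omega>"
          and g = "\<lambda>\<omega>. nat \<lceil>real (Suc n) * R \<omega>\<rceil>"])
      (use R(1) X_measurable in \<open>simp_all\<close>)
  define g where "g \<omega> = lim (\<lambda>n. X (d n (R \<omega>)) \<omega>)" for \<omega>
  have "g \<in> borel_measurable M"
    unfolding g_def using meas by (rule borel_measurable_lim_metric)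
  then have "g \<in> borel_measurable (P x)"
    using sets_P by (simp cong: measurable_cong_sets)
  then have "g \<in> completion (P x) \<rightarrow>\<^sub>M borel" by (rule measurable_completion)
  moreover have "AE \<omega> in P x. g \<omega> = X (R \<omega>) \<omega>"
    using cont
  proof eventually_elim
    case (elim \<omega>)
    have "((\<lambda>n. X (d n (R \<omega>)) \<omega>) \<longlongrightarrow> X (R \<omega>) \<omega>) sequentially"
    proof (rule continuous_on_tendsto_compose[OF elim d_lim[OF R(2)]])
      show "\<forall>\<^sub>F n in sequentially. d n (R \<omega>) \<in> {0..}"
        by (intro always_eventually allI) (simp only: d_def atLeast_iff, intro divide_nonneg_nonneg of_nat_0_le_iff)
    qed (use R(2) in simp)
    then show ?case unfolding g_def by (rule limI)
  qed
  ultimately show ?thesis by (rule measurable_completion_AE) simp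
qed

lemma stopping_time_measurable:
  assumes T: "stopping_time (natural_filtration M X) T"
  shows "T \<in> borel_measurable M"
proof (rule borel_measurableI_le)
  let ?F = "natural_filtration M X"
  fix t
  have "{\<omega> \<in> space (?F t). T \<omega> \<le> t} \<in> sets (?F t)"
    using stopping_timeD[OF T, of t] by (simp add: pred_def)
  moreover have "sets (?F t) \<subseteq> sets M"
    unfolding natural_filtration_def
    by (subst sets_measure_of) (auto intro!: sets.sigma_sets_subset measurable_sets[OF X_measurable])
  ultimately show "{\<omega> \<in> space M. T \<omega> \<le> t} \<in> sets M"
    using filtration.space_F[OF filtration_natural_filtration, of M X t] by auto
qed

text \<open>For a rectangle this is the strong Markov property itself. Rectangles form an
  intersection-stable generator, and both sides respect complements and countable disjoint
  unions.\<close>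

lemma strong_markov_joint:
  assumes T: "stopping_time (natural_filtration M X) T"
    and D: "D \<in> sets (borel \<Otimes>\<^sub>M path_space)"
  defines "\<psi> \<equiv> \<lambda>\<omega>. (T \<omega>, path (\<lambda>s. X (enn2real (T \<omega>) + s)) \<omega>)"
  defines "k \<equiv> \<lambda>D \<omega>. emeasure (process_law P X (X (enn2real (T \<omega>)) \<omega>)) (Pair (T \<omega>) -` D)"
  shows "{\<omega> \<in> space M. T \<omega> < \<infinity> \<and> \<psi> \<omega> \<in> D} \<in> sets (completion (P x))"
    and "k D \<in> borel_measurable (completion (P x))"
    and "emeasure (completion (P x)) {\<omega> \<in> space M. T \<omega> < \<infinity> \<and> \<psi> \<omega> \<in> D} =
      (\<integral>\<^sup>+ \<omega>. k D \<omega> * indicator {\<omega> \<in> space M. T \<omega> < \<infinity>} \<omega> \<partial>completion (P x))"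
proof -
  let ?N = "completion (P x)"
  let ?F = "natural_filtration M X"
  interpret N: prob_space ?N by (rule prob_space_completion_P)
  note fil = filtration_natural_filtration[of M X]
  have finite_N: "emeasure ?N B \<noteq> \<infinity>" for B
    unfolding infinity_ennreal_def by (rule N.emeasure_finite)
  have space_N: "space ?N = space M" by (simp add: space_P)
  note T_M = stopping_time_measurable[OF T]
  have "T \<in> borel_measurable (P x)"
    using T_M sets_P by (simp cong: measurable_cong_sets)
  then have T_N: "T \<in> borel_measurable ?N" by (rule measurable_completion)
  have X_N: "(\<lambda>\<omega>. X (enn2real (T \<omega>) + s) \<omega>) \<in> ?N \<rightarrow>\<^sub>M borel" if "0 \<le> s" for s
    using T_M that by (intro measurable_at_random_time) auto
  have "(\<lambda>\<omega>. path (\<lambda>s. X (enn2real (T \<omega>) + s)) \<omega>) \<in> ?N \<rightarrow>\<^sub>M path_space"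
    unfolding path_def path_space_def by (rule measurable_restrict) (simp add: X_N)
  then have \<psi>: "\<psi> \<in> ?N \<rightarrow>\<^sub>M borel \<Otimes>\<^sub>M path_space"
    unfolding \<psi>_def using T_N by (rule measurable_Pair[rotated])
  have fin: "{\<omega> \<in> space M. T \<omega> < \<infinity>} \<in> sets ?N"
    using T_N unfolding space_N[symmetric] by measurable
  have hit: "{\<omega> \<in> space M. T \<omega> < \<infinity> \<and> \<psi> \<omega> \<in> D} \<in> sets ?N" if "D \<in> sets (borel \<Otimes>\<^sub>M path_space)" for D
  proof -
    have "\<psi> -` D \<inter> space ?N \<in> sets ?N" by (rule measurable_sets[OF \<psi> that])
    from sets.Int[OF fin this] show ?thesis
      by (rule back_subst[where P = "\<lambda>A. A \<in> sets ?N"]) (auto simp: space_P)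
  qed
  show "{\<omega> \<in> space M. T \<omega> < \<infinity> \<and> \<psi> \<omega> \<in> D} \<in> sets ?N" by (rule hit[OF D])
  have k: "k D \<in> borel_measurable ?N" if D: "D \<in> sets (borel \<Otimes>\<^sub>M path_space)" for D
    unfolding k_def
  proof (rule emeasure_measurable_subprob_algebra2)
    have "(\<lambda>\<omega>. X (enn2real (T \<omega>)) \<omega>) \<in> ?N \<rightarrow>\<^sub>M borel" using X_N[of 0] by simp
    then show "(\<lambda>\<omega>. process_law P X (X (enn2real (T \<omega>)) \<omega>)) \<in> ?N \<rightarrow>\<^sub>M subprob_algebra path_space"
      by (rule measurable_compose[OF _ measurable_prob_algebraD[OF measurable_process_law]])
    have "(\<lambda>z. (T (fst z), snd z)) \<in> ?N \<Otimes>\<^sub>M path_space \<rightarrow>\<^sub>M borel \<Otimes>\<^sub>M path_space"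
      using T_N by measurable
    then have "(\<lambda>z. (T (fst z), snd z)) -` D \<inter> space (?N \<Otimes>\<^sub>M path_space) \<in> sets (?N \<Otimes>\<^sub>M path_space)"
      using D by (rule measurable_sets)
    also have "(\<lambda>z. (T (fst z), snd z)) -` D \<inter> space (?N \<Otimes>\<^sub>M path_space) = (SIGMA \<omega>:space ?N. Pair (T \<omega>) -` D)"
      using sets.sets_into_space[OF D] by (auto simp: space_pair_measure)
    finally show "(SIGMA \<omega>:space ?N. Pair (T \<omega>) -` D) \<in> sets (?N \<Otimes>\<^sub>M path_space)" .
  qed
  show "k D \<in> borel_measurable ?N" by (rule k[OF D])
  let ?ind = "indicator {\<omega> \<in> space M. T \<omega> < \<infinity>} :: 'w \<Rightarrow> ennreal"
  let ?claim = "\<lambda>D. emeasure ?N {\<omega> \<in> space M. T \<omega> < \<infinity> \<and> \<psi> \<omega> \<in> D} = (\<integral>\<^sup>+ \<omega>. k D \<omega> * ?ind \<omega> \<partial>?N)"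
  have slice: "Pair c -` D \<in> sets path_space" if "D \<in> sets (borel \<Otimes>\<^sub>M path_space)" for D and c :: ennreal
    using that by (rule sets_Pair1)
  \<comment> \<open>The condition on \<open>T\<close> is absorbed into the event of the past, as
    \<open>T\<close> is measurable for its own pre-sigma-algebra.\<close>
  have rect: "?claim (S \<times> C)" if S: "S \<in> sets borel" and C: "C \<in> sets path_space" for S C
  proof -
    let ?A = "{\<omega> \<in> space M. T \<omega> \<in> S}"
    have "T -` S \<inter> space (filtration.pre_sigma (space M) ?F T) \<in> sets (filtration.pre_sigma (space M) ?F T)"
      by (rule measurable_sets[OF filtration.measurable_stopping_time_pre_sigma[OF fil T] S])
    also have "T -` S \<inter> space (filtration.pre_sigma (space M) ?F T) = ?A"
      by (auto simp: filtration.space_pre_sigma[OF fil])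
    finally have A: "?A \<in> sets (filtration.pre_sigma (space M) ?F T)" .
    have "emeasure ?N {\<omega> \<in> ?A. T \<omega> < \<infinity> \<and> path (\<lambda>s. X (enn2real (T \<omega>) + s)) \<omega> \<in> C} =
      (\<integral>\<^sup>+ \<omega>. emeasure (process_law P X (X (enn2real (T \<omega>)) \<omega>)) C * indicator {\<omega> \<in> ?A. T \<omega> < \<infinity>} \<omega> \<partial>?N)"
      using markov T A C unfolding strong_markov_def by blast
    also have "{\<omega> \<in> ?A. T \<omega> < \<infinity> \<and> path (\<lambda>s. X (enn2real (T \<omega>) + s)) \<omega> \<in> C} =
      {\<omega> \<in> space M. T \<omega> < \<infinity> \<and> \<psi> \<omega> \<in> S \<times> C}"
      by (auto simp: \<psi>_def)
    also have "(\<integral>\<^sup>+ \<omega>. emeasure (process_law P X (X (enn2real (T \<omega>)) \<omega>)) C * indicator {\<omega> \<in> ?A. T \<omega> < \<infinity>} \<omega> \<partial>?N)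
      = (\<integral>\<^sup>+ \<omega>. k (S \<times> C) \<omega> * ?ind \<omega> \<partial>?N)"
      by (intro nn_integral_cong) (auto simp: k_def indicator_def)
    finally show ?thesis .
  qed
  \<comment> \<open>For the complement step: both sides are subtracted from their finite values on
    the whole space.\<close>
  have whole: "?claim (space borel \<times> space path_space)"
    by (rule rect) auto
  have k_whole: "k (space borel \<times> space path_space) \<omega> = 1" for \<omega>
    using prob_space.emeasure_space_1[OF prob_space_process_law] sets_eq_imp_space_eq[OF sets_process_law]
    by (simp add: k_def)
  from D show "?claim D"
    unfolding sets_pair_measure
  proof (induction rule: sigma_sets_induct_disjoint[OF Int_stable_pair_measure_generator pair_measure_closed,
        consumes 1, case_names basic empty compl union])
    case (basic A)
    then show ?case using rect by auto
  next
    case empty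
    then show ?case by (simp add: k_def)
  next
    case (compl A)
    then have A: "A \<in> sets (borel \<Otimes>\<^sub>M path_space)" by (simp add: sets_pair_measure)
    let ?U = "space borel \<times> space path_space :: (ennreal \<times> (real \<Rightarrow> 'v)) set"
    have U: "?U - A \<in> sets (borel \<Otimes>\<^sub>M path_space)"
      using sets.compl_sets[OF A] by (simp add: space_pair_measure)
    have "{\<omega> \<in> space M. T \<omega> < \<infinity> \<and> \<psi> \<omega> \<in> ?U - A} =
      {\<omega> \<in> space M. T \<omega> < \<infinity> \<and> \<psi> \<omega> \<in> ?U} - {\<omega> \<in> space M. T \<omega> < \<infinity> \<and> \<psi> \<omega> \<in> A}"
      by auto
    also have "emeasure ?N \<dots> = emeasure ?N {\<omega> \<in> space M. T \<omega> < \<infinity> \<and> \<psi> \<omega> \<in> ?U}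
        - emeasure ?N {\<omega> \<in> space M. T \<omega> < \<infinity> \<and> \<psi> \<omega> \<in> A}"
    proof (rule emeasure_Diff)
      show "emeasure ?N {\<omega> \<in> space M. T \<omega> < \<infinity> \<and> \<psi> \<omega> \<in> A} \<noteq> \<infinity>"
        by (rule finite_N)
      show "{\<omega> \<in> space M. T \<omega> < \<infinity> \<and> \<psi> \<omega> \<in> A} \<subseteq> {\<omega> \<in> space M. T \<omega> < \<infinity> \<and> \<psi> \<omega> \<in> ?U}"
        using sets.sets_into_space[OF A] by (auto simp: space_pair_measure)
      have "?U \<in> sets (borel \<Otimes>\<^sub>M path_space)"
        using sets.top[of "borel \<Otimes>\<^sub>M path_space"] by (simp only: space_pair_measure)
      then show "{\<omega> \<in> space M. T \<omega> < \<infinity> \<and> \<psi> \<omega> \<in> ?U} \<in> sets ?N" by (rule hit)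
    qed (rule hit[OF A])
    also have "\<dots> = (\<integral>\<^sup>+ \<omega>. k ?U \<omega> * ?ind \<omega> \<partial>?N) - (\<integral>\<^sup>+ \<omega>. k A \<omega> * ?ind \<omega> \<partial>?N)"
      using whole compl by simp
    also have "\<dots> = (\<integral>\<^sup>+ \<omega>. k ?U \<omega> * ?ind \<omega> - k A \<omega> * ?ind \<omega> \<partial>?N)"
    proof (rule nn_integral_diff[symmetric])
      show "(\<integral>\<^sup>+ \<omega>. k A \<omega> * ?ind \<omega> \<partial>?N) \<noteq> \<infinity>"
        unfolding compl(2)[symmetric] by (rule finite_N)
      show "(\<lambda>\<omega>. k ?U \<omega> * ?ind \<omega>) \<in> borel_measurable ?N"
        using fin unfolding k_whole by simp
      show "(\<lambda>\<omega>. k A \<omega> * ?ind \<omega>) \<in> borel_measurable ?N"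
        using fin k[OF A] by simp
      have "k A \<omega> \<le> k ?U \<omega>" for \<omega>
        unfolding k_def using sets.sets_into_space[OF A]
        by (intro emeasure_mono) (auto simp: space_pair_measure sets_process_law)
      then show "AE \<omega> in ?N. k A \<omega> * ?ind \<omega> \<le> k ?U \<omega> * ?ind \<omega>"
        by (simp add: mult_right_mono)
    qed
    also have "\<dots> = (\<integral>\<^sup>+ \<omega>. k (?U - A) \<omega> * ?ind \<omega> \<partial>?N)"
    proof (rule nn_integral_cong)
      fix \<omega>
      have "k (?U - A) \<omega> = k ?U \<omega> - k A \<omega>"
      proof -
        interpret L: prob_space "process_law P X (X (enn2real (T \<omega>)) \<omega>)" by (rule prob_space_process_law)
        have "Pair (T \<omega>) -` (?U - A) = Pair (T \<omega>) -` ?U - Pair (T \<omega>) -` A" by auto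
        then show ?thesis
          unfolding k_def using slice[OF A] sets.sets_into_space[OF A]
          by (simp only:) (intro emeasure_Diff L.emeasure_finite, auto simp: sets_process_law space_pair_measure)
      qed
      then show "k ?U \<omega> * ?ind \<omega> - k A \<omega> * ?ind \<omega> = k (?U - A) \<omega> * ?ind \<omega>"
        by (simp add: indicator_def)
    qed
    finally show ?case .
  next
    case (union A)
    then have A: "\<And>i. A i \<in> sets (borel \<Otimes>\<^sub>M path_space)" by (auto simp: sets_pair_measure)
    have "{\<omega> \<in> space M. T \<omega> < \<infinity> \<and> \<psi> \<omega> \<in> (\<Union>i. A i)} = (\<Union>i. {\<omega> \<in> space M. T \<omega> < \<infinity> \<and> \<psi> \<omega> \<in> A i})"
      by auto
    also have "emeasure ?N \<dots> = (\<Sum>i. emeasure ?N {\<omega> \<in> space M. T \<omega> < \<infinity> \<and> \<psi> \<omega> \<in> A i})"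
      using hit[OF A] union(1) by (intro suminf_emeasure[symmetric]) (auto simp: disjoint_family_on_def)
    also have "\<dots> = (\<Sum>i. \<integral>\<^sup>+ \<omega>. k (A i) \<omega> * ?ind \<omega> \<partial>?N)"
      using union(3) by simp
    also have "\<dots> = (\<integral>\<^sup>+ \<omega>. (\<Sum>i. k (A i) \<omega> * ?ind \<omega>) \<partial>?N)"
      using k[OF A] fin by (intro nn_integral_suminf[symmetric]) simp
    also have "\<dots> = (\<integral>\<^sup>+ \<omega>. k (\<Union>i. A i) \<omega> * ?ind \<omega> \<partial>?N)"
    proof (rule nn_integral_cong)
      fix \<omega>
      have "(\<Sum>i. k (A i) \<omega>) = k (\<Union>i. A i) \<omega>"
        unfolding k_def vimage_UN
      proof (rule suminf_emeasure)
        show "disjoint_family (\<lambda>i. Pair (T \<omega>) -` A i)"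
          using union(1) unfolding disjoint_family_on_def by blast
      qed (use slice[OF A] in \<open>auto simp: sets_process_law\<close>)
      then show "(\<Sum>i. k (A i) \<omega> * ?ind \<omega>) = k (\<Union>i. A i) \<omega> * ?ind \<omega>"
        by simp
    qed
    finally show ?case .
  qed
qed

text \<open>Up to null sets, staying in \<open>G \<theta>\<close> splits into \<open>B\<close>, no
  exit by time \<open>t\<close>, and \<open>S \<theta>\<close>, an exit followed by staying in
  \<open>G \<theta>\<close> for the remaining time; before the exit nothing can go wrong because
  \<open>A \<subseteq> G \<theta>\<close>. The weights sum to 1 on \<open>B\<close>. The weighted
  probabilities of the \<open>S \<theta>\<close> sum to the integral of the expression in
  \<open>cancel\<close> at the exit point, which is 0.\<close>

lemma exit_expansion:
  assumes A: "open A" "A \<noteq> UNIV" and x: "x \<in> A" and t: "0 \<le> t" and \<Theta>: "finite \<Theta>"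
    and G: "\<And>\<theta>. \<theta> \<in> \<Theta> \<Longrightarrow> open (G \<theta>)" "\<And>\<theta>. \<theta> \<in> \<Theta> \<Longrightarrow> G \<theta> \<noteq> UNIV" "\<And>\<theta>. \<theta> \<in> \<Theta> \<Longrightarrow> A \<subseteq> G \<theta>"
    and sg: "sum sg \<Theta> = 1"
    and cancel: "\<And>y u. y \<in> closure A \<Longrightarrow> y \<notin> A \<Longrightarrow> 0 \<le> u \<Longrightarrow>
      (\<Sum>\<theta>\<in>\<Theta>. sg \<theta> * measure (process_law P X y) (stays (G \<theta>) u)) = 0"
  shows "cprob P x (\<lambda>\<omega>. exit_time X A \<omega> > ennreal t) =
    (\<Sum>\<theta>\<in>\<Theta>. sg \<theta> * cprob P x (\<lambda>\<omega>. \<forall>s\<in>{0..t}. X s \<omega> \<in> G \<theta>))"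
proof -
  let ?N = "completion (P x)"
  interpret N: prob_space ?N by (rule prob_space_completion_P)
  define T where "T = raw_exit_time X A"
  define \<tau> where "\<tau> \<omega> = enn2real (T \<omega>)" for \<omega>
  define \<psi> where "\<psi> \<omega> = (T \<omega>, path (\<lambda>s. X (\<tau> \<omega> + s)) \<omega>)" for \<omega>
  define D where "D \<theta> = {z \<in> space (borel \<Otimes>\<^sub>M path_space). fst z \<le> ennreal t \<and>
    snd z \<in> stays (G \<theta>) (t - enn2real (fst z))}" for \<theta>
  define L where "L \<omega> = process_law P X (X (\<tau> \<omega>) \<omega>)" for \<omega>
  have T: "stopping_time (natural_filtration M X) T"
    unfolding T_def by (rule stopping_time_raw_exit_time)
  have D: "D \<theta> \<in> sets (borel \<Otimes>\<^sub>M path_space)" for \<theta>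
    unfolding D_def by (rule sets_stays_remaining)
  note joint = strong_markov_joint[OF T D, folded \<tau>_def, folded \<psi>_def L_def, where x = x]
  define S where "S \<theta> = {\<omega> \<in> space M. T \<omega> < \<infinity> \<and> \<psi> \<omega> \<in> D \<theta>}" for \<theta>
  have S: "S \<theta> \<in> sets ?N" for \<theta>
    unfolding S_def by (rule joint(1))
  \<comment> \<open>Real-valued, because the weights may be negative and the signed sum has to go
    under the integral.\<close>
  define k where "k \<theta> \<omega> = measure (L \<omega>) (Pair (T \<omega>) -` D \<theta>) * indicator {\<omega> \<in> space M. T \<omega> < \<infinity>} \<omega>" for \<theta> \<omega>
  have prob_L: "prob_space (L \<omega>)" for \<omega>
    unfolding L_def by (rule prob_space_process_law)
  have kS: "integrable ?N (k \<theta>) \<and> measure ?N (S \<theta>) = (\<integral>\<omega>. k \<theta> \<omega> \<partial>?N)" for \<theta>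
  proof -
    have eq: "emeasure (L \<omega>) (Pair (T \<omega>) -` D \<theta>) * indicator {\<omega> \<in> space M. T \<omega> < \<infinity>} \<omega> = ennreal (k \<theta> \<omega>)" for \<omega>
    proof -
      interpret L: prob_space "L \<omega>" by (rule prob_L)
      show ?thesis by (simp add: k_def L.emeasure_eq_measure indicator_def)
    qed
    have "{\<omega> \<in> space M. T \<omega> < \<infinity>} \<in> sets M"
      using stopping_time_measurable[OF T] by measurable
    then have "k \<theta> \<in> borel_measurable ?N"
      unfolding k_def measure_def using joint(2)[of \<theta>] sets_P
      by (intro borel_measurable_times borel_measurable_enn2real borel_measurable_indicator) auto
    moreover have "norm (k \<theta> \<omega>) \<le> 1" for \<omega>
      using prob_space.prob_le_1[OF prob_L] by (simp add: k_def indicator_def)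
    ultimately have int: "integrable ?N (k \<theta>)"
      by (intro N.integrable_const_bound[where B = 1]) auto
    have nn: "0 \<le> k \<theta> \<omega>" for \<omega> by (simp add: k_def)
    have "emeasure ?N (S \<theta>) = (\<integral>\<^sup>+ \<omega>. ennreal (k \<theta> \<omega>) \<partial>?N)"
      unfolding S_def joint(3) eq ..
    also have "\<dots> = ennreal (\<integral>\<omega>. k \<theta> \<omega> \<partial>?N)"
      using int nn by (intro nn_integral_eq_integral) auto
    finally have "ennreal (measure ?N (S \<theta>)) = ennreal (\<integral>\<omega>. k \<theta> \<omega> \<partial>?N)"
      unfolding N.emeasure_eq_measure .
    then show ?thesis
      using int nn by (subst (asm) ennreal_inj) (auto intro: integral_nonneg_AE)
  qed
  have good: "AE \<omega> in P x. X 0 \<omega> = x \<and> continuous_on {0..} (\<lambda>t. X t \<omega>)"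
    using start[of x] cont[of x] by eventually_elim simp
  have closure: "X (\<tau> \<omega>) \<omega> \<in> closure A \<and> X (\<tau> \<omega>) \<omega> \<notin> A \<and> (\<forall>s. 0 \<le> s \<longrightarrow> s < \<tau> \<omega> \<longrightarrow> X s \<omega> \<in> A)"
    if \<omega>: "X 0 \<omega> = x" "continuous_on {0..} (\<lambda>t. X t \<omega>)" and fin: "T \<omega> < \<infinity>" for \<omega>
  proof -
    have out: "X (\<tau> \<omega>) \<omega> \<notin> A" and before: "\<And>s. 0 \<le> s \<Longrightarrow> s < \<tau> \<omega> \<Longrightarrow> X s \<omega> \<in> A"
      using raw_exit_time_finite[of X \<omega> A, OF \<omega>(2) A] fin by (simp_all add: T_def \<tau>_def)
    \<comment> \<open>The path starts in \<open>A\<close> and is outside at the exit time, so there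
      are earlier times; they exhibit the exit point as a limit of points of
      \<open>A\<close>.\<close>
    have "\<tau> \<omega> \<noteq> 0" using out x \<omega>(1) by auto
    then have pos: "0 < \<tau> \<omega>" by (simp add: \<tau>_def less_le)
    have "X (\<tau> \<omega>) \<omega> \<in> closure A"
      unfolding closure_approachable
    proof (intro allI impI)
      fix e :: real assume "0 < e"
      then obtain d where d: "0 < d" "\<And>s. 0 \<le> s \<Longrightarrow> dist s (\<tau> \<omega>) < d \<Longrightarrow> dist (X s \<omega>) (X (\<tau> \<omega>) \<omega>) < e"
        using \<omega>(2) pos unfolding continuous_on_iff by (metis atLeast_iff less_imp_le)
      define s where "s = max 0 (\<tau> \<omega> - d / 2)"
      have "0 \<le> s" "s < \<tau> \<omega>" "dist s (\<tau> \<omega>) < d" using pos d(1) by (auto simp: s_def dist_real_def)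
      then show "\<exists>y\<in>A. dist y (X (\<tau> \<omega>) \<omega>) < e" using before d(2) by blast
    qed
    then show ?thesis using out before by blast
  qed
  have le_fin: "T \<omega> \<le> ennreal t \<Longrightarrow> T \<omega> < \<infinity> \<and> T \<omega> = ennreal (\<tau> \<omega>) \<and> 0 \<le> \<tau> \<omega> \<and> \<tau> \<omega> \<le> t" for \<omega>
    using t by (cases "T \<omega>") (auto simp: \<tau>_def top_unique)
  have slice: "Pair (T \<omega>) -` D \<theta> = (if T \<omega> \<le> ennreal t then stays (G \<theta>) (t - \<tau> \<omega>) else {})" for \<theta> \<omega>
    by (auto simp: D_def \<tau>_def space_pair_measure stays_def)
  have "AE \<omega> in ?N. (\<Sum>\<theta>\<in>\<Theta>. sg \<theta> * k \<theta> \<omega>) = 0"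
    using AE_completion[OF good]
  proof eventually_elim
    case (elim \<omega>)
    show ?case
    proof (cases "T \<omega> \<le> ennreal t")
      case True
      have "(\<Sum>\<theta>\<in>\<Theta>. sg \<theta> * measure (L \<omega>) (stays (G \<theta>) (t - \<tau> \<omega>))) = 0"
        unfolding L_def using closure[of \<omega>] elim le_fin[OF True] by (intro cancel) auto
      then have "(\<Sum>\<theta>\<in>\<Theta>. sg \<theta> * measure (L \<omega>) (stays (G \<theta>) (t - \<tau> \<omega>))) *
          indicator {\<omega> \<in> space M. T \<omega> < \<infinity>} \<omega> = (0::real)" by simp
      then show ?thesis using True by (simp add: k_def slice sum_distrib_right mult.assoc)
    next
      case False
      then show ?thesis by (simp add: k_def slice)
    qed
  qed
  then have "(\<integral>\<omega>. (\<Sum>\<theta>\<in>\<Theta>. sg \<theta> * k \<theta> \<omega>) \<partial>?N) = 0"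
    by (rule integral_eq_zero_AE)
  then have sum_S: "(\<Sum>\<theta>\<in>\<Theta>. sg \<theta> * measure ?N (S \<theta>)) = 0"
    using kS by simp
  have seen: "T \<omega> \<le> ennreal t \<longleftrightarrow> (\<exists>s\<in>{0..t}. X s \<omega> \<notin> A)" if "continuous_on {0..} (\<lambda>t. X t \<omega>)" for \<omega>
    using raw_exit_time_le_iff[OF t, of X A \<omega>] exit_seen_iff[of X \<omega> A t, OF that A t] by (simp add: T_def)
  define B where "B = {\<omega> \<in> space M. \<not> T \<omega> \<le> ennreal t}"
  have "B \<in> sets M"
    unfolding B_def using stopping_time_measurable[OF T] by measurable
  then have B: "B \<in> sets ?N" using sets_P by auto
  have exit: "cprob P x (\<lambda>\<omega>. exit_time X A \<omega> > ennreal t) = measure ?N B"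
  proof -
    have "cprob P x (\<lambda>\<omega>. exit_time X A \<omega> > ennreal t) = measure ?N {\<omega> \<in> space (P x). \<omega> \<in> B}"
      unfolding cprob_def
    proof (rule measure_completion_cong_AE)
      show "Measurable.pred ?N (\<lambda>\<omega>. \<omega> \<in> B)" using B by measurable
      show "AE \<omega> in P x. ennreal t < exit_time X A \<omega> \<longleftrightarrow> \<omega> \<in> B"
        using good AE_space
      proof eventually_elim
        case (elim \<omega>)
        then show ?case
          using seen[of \<omega>] exit_time_greater_iff[of X \<omega> A t, OF _ A(1) t] by (auto simp: B_def space_P)
      qed
    qed
    also have "{\<omega> \<in> space (P x). \<omega> \<in> B} = B" by (auto simp: B_def space_P)
    finally show ?thesis .
  qed
  have E: "cprob P x (\<lambda>\<omega>. \<forall>s\<in>{0..t}. X s \<omega> \<in> G \<theta>) = measure ?N B + measure ?N (S \<theta>)" if \<theta>: "\<theta> \<in> \<Theta>" for \<theta>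
  proof -
    have "cprob P x (\<lambda>\<omega>. \<forall>s\<in>{0..t}. X s \<omega> \<in> G \<theta>) = measure ?N {\<omega> \<in> space (P x). \<omega> \<in> B \<union> S \<theta>}"
      unfolding cprob_def
    proof (rule measure_completion_cong_AE)
      show "Measurable.pred ?N (\<lambda>\<omega>. \<omega> \<in> B \<union> S \<theta>)" using B S by measurable
      show "AE \<omega> in P x. (\<forall>s\<in>{0..t}. X s \<omega> \<in> G \<theta>) \<longleftrightarrow> \<omega> \<in> B \<union> S \<theta>"
        using good AE_space
      proof eventually_elim
        case (elim \<omega>)
        then have \<omega>: "X 0 \<omega> = x" "continuous_on {0..} (\<lambda>t. X t \<omega>)" "\<omega> \<in> space M" by (auto simp: space_P)
        show ?case
        proof (cases "T \<omega> \<le> ennreal t")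
          case False
          then show ?thesis using seen[OF \<omega>(2)] G(3)[OF \<theta>] \<omega> by (auto simp: B_def)
        next
          case True
          note fin = le_fin[OF True]
          have cont': "continuous_on {0..} (\<lambda>s. X (\<tau> \<omega> + s) \<omega>)"
            using fin by (intro continuous_on_compose2[OF \<omega>(2)] continuous_intros) auto
          have "\<omega> \<in> B \<union> S \<theta> \<longleftrightarrow> path (\<lambda>s. X (\<tau> \<omega> + s)) \<omega> \<in> stays (G \<theta>) (t - \<tau> \<omega>)"
            using True fin \<omega>(3) slice[of \<omega> \<theta>] by (auto simp: B_def S_def \<psi>_def)
          also have "\<dots> \<longleftrightarrow> (\<forall>s\<in>{0..t - \<tau> \<omega>}. X (\<tau> \<omega> + s) \<omega> \<in> G \<theta>)"
            unfolding path_def using fin by (intro stays_iff[OF cont'] G \<theta>) auto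
          also have "\<dots> \<longleftrightarrow> (\<forall>s\<in>{0..t}. X s \<omega> \<in> G \<theta>)"
          proof
            assume *: "\<forall>s\<in>{0..t - \<tau> \<omega>}. X (\<tau> \<omega> + s) \<omega> \<in> G \<theta>"
            show "\<forall>s\<in>{0..t}. X s \<omega> \<in> G \<theta>"
            proof
              fix s assume s: "s \<in> {0..t}"
              show "X s \<omega> \<in> G \<theta>"
              proof (cases "s < \<tau> \<omega>")
                case True
                then show ?thesis using closure[OF \<omega>(1,2)] fin s G(3)[OF \<theta>] by auto
              next
                case False
                then show ?thesis using *[rule_format, of "s - \<tau> \<omega>"] s by simp
              qed
            qed
          qed (use fin in auto)
          finally show ?thesis by simp
        qed
      qed
    qed
    also have "{\<omega> \<in> space (P x). \<omega> \<in> B \<union> S \<theta>} = B \<union> S \<theta>" by (auto simp: B_def S_def space_P)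
    also have "measure ?N (B \<union> S \<theta>) = measure ?N B + measure ?N (S \<theta>)"
      using slice by (intro N.finite_measure_Union B S) (auto simp: B_def S_def \<psi>_def D_def)
    finally show ?thesis .
  qed
  have "(\<Sum>\<theta>\<in>\<Theta>. sg \<theta> * cprob P x (\<lambda>\<omega>. \<forall>s\<in>{0..t}. X s \<omega> \<in> G \<theta>)) =
    (\<Sum>\<theta>\<in>\<Theta>. sg \<theta> * measure ?N B + sg \<theta> * measure ?N (S \<theta>))"
    by (intro sum.cong) (auto simp: E distrib_left)
  also have "\<dots> = measure ?N B"
    using sum_S sg by (simp add: sum.distrib sum_distrib_right[symmetric])
  finally show ?thesis using exit by simp
qed

text \<open>Used twice: with a group element for the invariance, and with an orthogonal projection
  for the independence.\<close>

lemma transformed_path: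
  assumes g: "continuous_on UNIV g" and G: "open G" "G \<noteq> UNIV" and u: "0 \<le> u"
  shows "path (\<lambda>t \<omega>. g (X t \<omega>)) \<in> P y \<rightarrow>\<^sub>M path_space"
    and "AE \<omega> in P y. path (\<lambda>t \<omega>. g (X t \<omega>)) \<omega> \<in> stays G u \<longleftrightarrow> (\<forall>s\<in>{0..u}. g (X s \<omega>) \<in> G)"
    and "cprob P y (\<lambda>\<omega>. \<forall>s\<in>{0..u}. g (X s \<omega>) \<in> G) =
      measure (P y) (path (\<lambda>t \<omega>. g (X t \<omega>)) -` stays G u \<inter> space (P y))"
proof -
  let ?Y = "path (\<lambda>t \<omega>. g (X t \<omega>))"
  show Y: "?Y \<in> P y \<rightarrow>\<^sub>M path_space"
    unfolding path_def path_space_def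
    by (rule measurable_restrict)
      (auto intro: measurable_compose[OF X_measurable_P borel_measurable_continuous_onI[OF g]])
  show ae: "AE \<omega> in P y. ?Y \<omega> \<in> stays G u \<longleftrightarrow> (\<forall>s\<in>{0..u}. g (X s \<omega>) \<in> G)"
    using cont
  proof eventually_elim
    case (elim \<omega>)
    have "continuous_on {0..} (\<lambda>s. g (X s \<omega>))"
      using continuous_on_compose2[OF g elim] by simp
    then show ?case unfolding path_def by (rule stays_iff[OF _ G u])
  qed
  have meas: "?Y -` stays G u \<inter> space (P y) \<in> sets (P y)"
    by (rule measurable_sets[OF Y sets_stays])
  have eq: "{\<omega> \<in> space (P y). ?Y \<omega> \<in> stays G u} = ?Y -` stays G u \<inter> space (P y)" by auto
  have "Measurable.pred (completion (P y)) (\<lambda>\<omega>. ?Y \<omega> \<in> stays G u)"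
    by (rule measurable_completion) (use meas eq in \<open>simp add: pred_def\<close>)
  then have "cprob P y (\<lambda>\<omega>. \<forall>s\<in>{0..u}. g (X s \<omega>) \<in> G) =
    measure (completion (P y)) {\<omega> \<in> space (P y). ?Y \<omega> \<in> stays G u}"
    unfolding cprob_def using ae by (intro measure_completion_cong_AE) auto
  then show "cprob P y (\<lambda>\<omega>. \<forall>s\<in>{0..u}. g (X s \<omega>) \<in> G) =
      measure (P y) (?Y -` stays G u \<inter> space (P y))"
    using meas unfolding eq by simp
qed

lemma cprob_stays_start_outside:
  assumes "y \<notin> G" "0 \<le> u"
  shows "cprob P y (\<lambda>\<omega>. \<forall>s\<in>{0..u}. X s \<omega> \<in> G) = 0"
proof -
  have "AE \<omega> in P y. (\<forall>s\<in>{0..u}. X s \<omega> \<in> G) \<longleftrightarrow> False"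
    using start by eventually_elim (use assms in force)
  then have "cprob P y (\<lambda>\<omega>. \<forall>s\<in>{0..u}. X s \<omega> \<in> G) = measure (completion (P y)) {\<omega> \<in> space (P y). False}"
    unfolding cprob_def by (intro measure_completion_cong_AE) auto
  then show ?thesis by simp
qed

end

section \<open>Reflections and independent coordinates\<close>

lemma continuous_on_affine_weyl:
  fixes r :: "real ^ 'k::{finite,linorder} \<Rightarrow> real ^ 'k::{finite,linorder}"
  assumes "r \<in> affine_weyl_B"
  shows "continuous_on UNIV r"
  using assms unfolding affine_weyl_B_def
  by (auto intro!: continuous_intros continuous_on_vec_lambda)

lemma open_block_region: "open (block_region b)"
  unfolding block_region_def
  by (cases "Min b = Max b")
    (auto intro!: open_Collect_conj open_Collect_less continuous_intros)

lemma block_region_ne_UNIV: "block_region b \<noteq> UNIV"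
proof -
  have "0 \<notin> block_region b" by (simp add: block_region_def)
  then show ?thesis by blast
qed

lemma finite_config_blocks: "finite (config_blocks \<theta>)"
  by (rule finite_subset[of _ "Pow UNIV"]) auto

lemma open_config_region: "open (config_region \<theta>)"
proof -
  have "config_region \<theta> = (\<Inter>b\<in>config_blocks \<theta>. block_region b)"
    by (auto simp: config_region_def)
  then show ?thesis
    using finite_config_blocks open_block_region by (auto intro!: open_INT)
qed

lemma config_region_ne_UNIV:
  assumes "\<theta> \<in> configs"
  shows "config_region \<theta> \<noteq> UNIV"
  using config_region_pos[OF assms, of 0] by fastforce

lemma open_alcove: "open (alcove_B :: (real ^ 'k::{finite,linorder}) set)"
proof -
  have eq: "(alcove_B :: (real ^ 'k::{finite,linorder}) set) = (\<Inter>i. \<Inter>j. {x. i < j \<longrightarrow> x $ j < x $ i}) \<inter>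
    (\<Inter>i. {x. 0 < x $ i}) \<inter> {x. x $ index1 + x $ index2 < 1}"
    by (auto simp: alcove_B_def)
  have "open {x :: real ^ 'k::{finite,linorder}. i < j \<longrightarrow> x $ j < x $ i}" for i j
    by (cases "i < j") (auto intro!: open_Collect_less continuous_intros)
  then show ?thesis
    unfolding eq by (intro open_Int open_INT open_Collect_less continuous_intros ballI) auto
qed

lemma closure_alcove:
  fixes y :: "real ^ 'k::{finite,linorder}"
  assumes "y \<in> closure alcove_B"
  shows "p < q \<Longrightarrow> y $ q \<le> y $ p" "0 \<le> y $ p" "y $ index1 + y $ index2 \<le> 1"
proof -
  have *: "y \<in> S" if "closed S" "alcove_B \<subseteq> S" for S
    using closure_minimal[OF that(2,1)] assms by auto
  show "y $ q \<le> y $ p" if "p < q"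
  proof -
    have "y \<in> {x. x $ q \<le> x $ p}"
      using that by (intro *) (auto simp: alcove_B_def less_imp_le intro!: closed_Collect_le continuous_intros)
    then show ?thesis by simp
  qed
  have "y \<in> {x. 0 \<le> x $ p}"
    by (intro *) (auto simp: alcove_B_def less_imp_le intro!: closed_Collect_le continuous_intros)
  then show "0 \<le> y $ p" by simp
  have "y \<in> {x. x $ index1 + x $ index2 \<le> 1}"
    by (intro *) (auto simp: alcove_B_def less_imp_le intro!: closed_Collect_le continuous_intros)
  then show "y $ index1 + y $ index2 \<le> 1" by simp
qed

section \<open>Coordinate subspaces and the factorization over blocks\<close>

definition coord_subspace :: "'k set \<Rightarrow> (real ^ 'k::finite) set" where
  "coord_subspace b = {v. \<forall>m. m \<notin> b \<longrightarrow> v $ m = 0}"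

lemma subspace_coord_subspace: "subspace (coord_subspace b)"
  by (auto simp: subspace_def coord_subspace_def)

lemma orthogonal_coord_subspace:
  "b \<inter> c = {} \<Longrightarrow> u \<in> coord_subspace b \<Longrightarrow> v \<in> coord_subspace c \<Longrightarrow> orthogonal u v"
  unfolding orthogonal_def inner_vec_def coord_subspace_def
  by (intro sum.neutral ballI) (auto simp: disjoint_iff)

lemma axis_mem_coord_subspace: "axis m (1::real) \<in> coord_subspace b \<longleftrightarrow> m \<in> b"
  by (auto simp: coord_subspace_def axis_def)

lemma coord_subspace_inject: "coord_subspace b = coord_subspace c \<Longrightarrow> b = c"
  using axis_mem_coord_subspace by blast

lemma orth_proj_coord_subspace: "orth_proj (coord_subspace b) v = (\<chi> m. if m \<in> b then v $ m else 0)"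
  unfolding orth_proj_def
proof (rule the_equality)
  show "(\<chi> m. if m \<in> b then v $ m else 0) \<in> coord_subspace b \<and>
    (\<forall>u\<in>coord_subspace b. orthogonal (v - (\<chi> m. if m \<in> b then v $ m else 0)) u)"
    by (auto simp: coord_subspace_def orthogonal_def inner_vec_def intro!: sum.neutral)
next
  fix y assume y: "y \<in> coord_subspace b \<and> (\<forall>u\<in>coord_subspace b. orthogonal (v - y) u)"
  have "y $ m = (if m \<in> b then v $ m else 0)" for m
  proof (cases "m \<in> b")
    case True
    then have "orthogonal (v - y) (axis m 1)" using y axis_mem_coord_subspace by blast
    then show ?thesis using True by (simp add: orthogonal_def inner_axis)
  qed (use y in \<open>auto simp: coord_subspace_def\<close>)
  then show "y = (\<chi> m. if m \<in> b then v $ m else 0)" by (simp add: vec_eq_iff)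
qed

lemma continuous_on_coord_proj:
  "continuous_on UNIV (orth_proj (coord_subspace b :: (real ^ 'k::finite) set))"
proof -
  have "continuous_on UNIV (\<lambda>v :: real ^ 'k::finite. \<chi> m. if m \<in> b then v $ m else 0)"
  proof (intro continuous_on_vec_lambda)
    show "continuous_on UNIV (\<lambda>v :: real ^ 'k::finite. if m \<in> b then v $ m else 0)" for m
      by (cases "m \<in> b") (auto intro!: continuous_intros)
  qed
  then show ?thesis by (simp add: orth_proj_coord_subspace cong: continuous_on_cong)
qed

text \<open>The condition involves only the coordinates \<open>Min b\<close> and
  \<open>Max b\<close>, which belong to \<open>b\<close> and survive the projection.\<close>

lemma coord_proj_block_region:
  assumes "b \<noteq> {}"
  shows "orth_proj (coord_subspace b) v \<in> block_region b \<longleftrightarrow> v \<in> block_region b"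
  using assms by (simp add: orth_proj_coord_subspace block_region_def)

lemma disjoint_config_blocks:
  assumes "\<theta> \<in> configs" "b \<in> config_blocks \<theta>" "c \<in> config_blocks \<theta>" "b \<noteq> c"
  shows "b \<inter> c = {}"
proof -
  have \<pi>: "snd \<theta> \<in> pair_partitions (- fst \<theta>)" and U: "\<Union> (snd \<theta>) = - fst \<theta>"
    using assms(1) by (auto simp: configs_def pair_partitions_def partition_on_def)
  consider "b \<in> snd \<theta>" "c \<in> snd \<theta>" | "b \<in> snd \<theta>" "c \<in> (\<lambda>l. {l}) ` fst \<theta>"
    | "b \<in> (\<lambda>l. {l}) ` fst \<theta>" "c \<in> snd \<theta>" | "b \<in> (\<lambda>l. {l}) ` fst \<theta>" "c \<in> (\<lambda>l. {l}) ` fst \<theta>"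
    using assms(2,3) by (auto simp: config_blocks_def)
  then show ?thesis
  proof cases
    case 1
    then show ?thesis using pair_partitions_same_block[OF \<pi>] assms(4) by blast
  qed (use U assms(4) in blast)+
qed

lemma config_block_nonempty: "\<theta> \<in> configs \<Longrightarrow> b \<in> config_blocks \<theta> \<Longrightarrow> b \<noteq> {}"
  by (auto elim: config_blockE)

text \<open>Distinct blocks are disjoint and hence span orthogonal coordinate subspaces, and each
  block condition can be read off from its own projection.\<close>

lemma cprob_config_region:
  fixes P :: "real ^ 'k::{finite,linorder} \<Rightarrow> 'w measure"
  assumes csm: "continuous_strong_markov M P X" and indep: "independent_orthogonal_components P X"
    and \<theta>: "\<theta> \<in> configs" and t: "0 \<le> t"
  shows "cprob P x (\<lambda>\<omega>. \<forall>s\<in>{0..t}. X s \<omega> \<in> config_region \<theta>) =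
    (\<Prod>b\<in>config_blocks \<theta>. cprob P x (\<lambda>\<omega>. \<forall>s\<in>{0..t}. X s \<omega> \<in> block_region b))"
proof -
  interpret continuous_strong_markov M P X by (rule csm)
  interpret Px: prob_space "P x" by (rule prob_space_P)
  let ?B = "config_blocks \<theta>"
  define Y where "Y V = path (\<lambda>t \<omega>. orth_proj V (X t \<omega>))" for V
  \<comment> \<open>Independence is indexed by the subspaces themselves, so the event must be a
    function of the subspace; the axis vectors in \<open>V\<close> recover the block.\<close>
  define A where "A V = stays (block_region {m. axis m 1 \<in> V}) t" for V :: "(real ^ 'k::{finite,linorder}) set"
  have A_coord: "A (coord_subspace b) = stays (block_region b) t" for b
    by (simp add: A_def axis_mem_coord_subspace)
  note tp = transformed_path[OF continuous_on_coord_proj open_block_region block_region_ne_UNIV t,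
      where y = x, folded Y_def]
  have inj: "inj_on coord_subspace ?B" by (rule inj_onI) (rule coord_subspace_inject)
  \<comment> \<open>The product rule is applied to a nonempty index set; the block of an arbitrary
    index provides an element.\<close>
  have ne: "coord_subspace ` ?B \<noteq> {}"
  proof -
    obtain b where "b \<in> ?B" "undefined \<in> b" using config_blocks_cover[OF \<theta>] .
    then show ?thesis by blast
  qed
  have "Px.indep_vars (\<lambda>_. path_space) Y (coord_subspace ` ?B)"
    unfolding Y_def
  proof (rule indep[unfolded independent_orthogonal_components_def, rule_format])
    show "pairwise (\<lambda>U U'. \<forall>u\<in>U. \<forall>u'\<in>U'. orthogonal u u') (coord_subspace ` ?B)"
    proof (rule pairwiseI)
      fix U U' assume "U \<in> coord_subspace ` ?B" "U' \<in> coord_subspace ` ?B" "U \<noteq> U'"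
      then obtain b c where "b \<in> ?B" "c \<in> ?B" "b \<noteq> c" "U = coord_subspace b" "U' = coord_subspace c"
        by blast
      then show "\<forall>u\<in>U. \<forall>u'\<in>U'. orthogonal u u'"
        using orthogonal_coord_subspace[OF disjoint_config_blocks[OF \<theta>]] by simp
    qed
  qed (auto simp: subspace_coord_subspace)
  then have "Px.prob (\<Inter>V\<in>coord_subspace ` ?B. Y V -` A V \<inter> space (P x)) =
    (\<Prod>V\<in>coord_subspace ` ?B. Px.prob (Y V -` A V \<inter> space (P x)))"
    by (rule Px.indep_varsD_finite) (use ne in \<open>auto simp: finite_config_blocks A_def sets_stays\<close>)
  also have "\<dots> = (\<Prod>b\<in>?B. Px.prob (Y (coord_subspace b) -` stays (block_region b) t \<inter> space (P x)))"
    by (simp add: prod.reindex[OF inj] A_coord)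
  also have "\<dots> = (\<Prod>b\<in>?B. cprob P x (\<lambda>\<omega>. \<forall>s\<in>{0..t}. X s \<omega> \<in> block_region b))"
    using config_block_nonempty[OF \<theta>]
    by (intro prod.cong refl) (simp add: tp(3)[symmetric] coord_proj_block_region)
  also have "Px.prob (\<Inter>V\<in>coord_subspace ` ?B. Y V -` A V \<inter> space (P x)) =
    cprob P x (\<lambda>\<omega>. \<forall>s\<in>{0..t}. X s \<omega> \<in> config_region \<theta>)"
  proof -
    let ?E = "\<Inter>V\<in>coord_subspace ` ?B. Y V -` A V \<inter> space (P x)"
    have E: "?E \<in> sets (P x)"
      using ne finite_config_blocks measurable_sets[OF tp(1) sets_stays]
      by (intro sets.finite_INT) (auto simp: A_coord)
    have E_space: "{\<omega> \<in> space (P x). \<omega> \<in> ?E} = ?E" using ne by auto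
    have "cprob P x (\<lambda>\<omega>. \<forall>s\<in>{0..t}. X s \<omega> \<in> config_region \<theta>) =
      measure (completion (P x)) {\<omega> \<in> space (P x). \<omega> \<in> ?E}"
      unfolding cprob_def
    proof (rule measure_completion_cong_AE)
      show "Measurable.pred (completion (P x)) (\<lambda>\<omega>. \<omega> \<in> ?E)"
        by (rule measurable_completion) (use E E_space in \<open>simp only: pred_def\<close>)
      have "AE \<omega> in P x. \<forall>b\<in>?B. Y (coord_subspace b) \<omega> \<in> stays (block_region b) t \<longleftrightarrow>
          (\<forall>s\<in>{0..t}. orth_proj (coord_subspace b) (X s \<omega>) \<in> block_region b)"
        using finite_config_blocks tp(2) by (intro AE_finite_allI) auto
      then show "AE \<omega> in P x. (\<forall>s\<in>{0..t}. X s \<omega> \<in> config_region \<theta>) \<longleftrightarrow> \<omega> \<in> ?E"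
        using AE_space
      proof eventually_elim
        case (elim \<omega>)
        then show ?case
          using config_block_nonempty[OF \<theta>]
          by (auto simp: A_coord coord_proj_block_region config_region_def)
      qed
    qed
    then show ?thesis using E unfolding E_space by simp
  qed
  finally show ?thesis .
qed

text \<open>Since \<open>r y = y\<close>, the processes \<open>X\<close> and \<open>r X\<close> have
  the same law under \<open>P y\<close>. Replacing a configuration by its image under the involution
  thus keeps the probability and reverses the sign.\<close>

lemma reflection_cancels:
  fixes P :: "real ^ 'k::{finite,linorder} \<Rightarrow> 'w measure"
  assumes card: "CARD('k) \<ge> 2" and csm: "continuous_strong_markov M P X"
    and inv: "\<And>w x. w \<in> affine_weyl_B \<Longrightarrow>
      distr (P x) path_space (path (\<lambda>t \<omega>. w (X t \<omega>))) = process_law P X (w x)"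
    and y: "y \<in> closure alcove_B" "y \<notin> alcove_B" and u: "0 \<le> u"
  shows "(\<Sum>\<theta>\<in>configs. config_sign \<theta> * measure (process_law P X y) (stays (config_region \<theta>) u)) = 0"
proof -
  interpret continuous_strong_markov M P X by (rule csm)
  define f where "f \<theta> = measure (process_law P X y) (stays (config_region \<theta>) u)" for \<theta>
  obtain r \<tau> where r: "r \<in> affine_weyl_B" "r y = y"
    and \<tau>: "\<And>\<theta>. \<theta> \<in> configs \<Longrightarrow> y \<in> config_region \<theta> \<Longrightarrow> \<tau> \<theta> \<in> configs \<and> \<tau> (\<tau> \<theta>) = \<theta> \<and>
      config_sign (\<tau> \<theta>) = - config_sign \<theta> \<and> (\<forall>v. v \<in> config_region (\<tau> \<theta>) \<longleftrightarrow> r v \<in> config_region \<theta>)"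
    using wall_reflection[OF card y(2) closure_alcove[OF y(1)]] by metis
  let ?\<Theta> = "{\<theta> \<in> configs. y \<in> config_region \<theta>}"
  have f_cprob: "f \<theta> = cprob P y (\<lambda>\<omega>. \<forall>s\<in>{0..u}. X s \<omega> \<in> config_region \<theta>)" if "\<theta> \<in> configs" for \<theta>
    unfolding f_def using pred_completion_stays(2)[OF open_config_region config_region_ne_UNIV[OF that] u]
    by simp
  have f_\<tau>: "f \<theta> = f (\<tau> \<theta>)" if \<theta>: "\<theta> \<in> configs" "y \<in> config_region \<theta>" for \<theta>
  proof -
    note tp = transformed_path[OF continuous_on_affine_weyl[OF r(1)] open_config_region config_region_ne_UNIV[OF \<theta>(1)] u]
    have "f \<theta> = measure (distr (P y) path_space (path (\<lambda>t \<omega>. r (X t \<omega>)))) (stays (config_region \<theta>) u)"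
      unfolding f_def inv[OF r(1)] r(2) ..
    also have "\<dots> = cprob P y (\<lambda>\<omega>. \<forall>s\<in>{0..u}. r (X s \<omega>) \<in> config_region \<theta>)"
      unfolding tp(3) by (rule measure_distr[OF tp(1) sets_stays])
    also have "\<dots> = f (\<tau> \<theta>)"
      using \<tau>[OF \<theta>] by (simp add: f_cprob)
    finally show ?thesis .
  qed
  have "(\<Sum>\<theta>\<in>?\<Theta>. config_sign \<theta> * f \<theta>) = 0"
  proof (rule sum_eq_0_sign_reversing[where \<tau> = \<tau>])
    fix \<theta> assume "\<theta> \<in> ?\<Theta>"
    then have \<theta>: "\<theta> \<in> configs" "y \<in> config_region \<theta>" by auto
    show "\<tau> \<theta> \<in> ?\<Theta>" "\<tau> (\<tau> \<theta>) = \<theta>" "config_sign (\<tau> \<theta>) * f (\<tau> \<theta>) = - (config_sign \<theta> * f \<theta>)"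
      using \<tau>[OF \<theta>] f_\<tau>[OF \<theta>] \<theta> r(2) by simp_all
  qed
  \<comment> \<open>Configurations whose region does not contain the starting point \<open>y\<close>
    contribute 0.\<close>
  moreover have "(\<Sum>\<theta>\<in>configs. config_sign \<theta> * f \<theta>) = (\<Sum>\<theta>\<in>?\<Theta>. config_sign \<theta> * f \<theta>)"
    using finite_configs cprob_stays_start_outside[OF _ u, of y]
    by (intro sum.mono_neutral_right) (auto simp: f_cprob)
  ultimately show ?thesis by (simp add: f_def)
qed

section \<open>Identification with the Pfaffian entries\<close>

lemma pbar1_block_region:
  "pbar1 P X x t l = cprob P x (\<lambda>\<omega>. \<forall>s\<in>{0..t}. X s \<omega> \<in> block_region {l})"
  unfolding pbar1_def block_region_singleton
  by (intro arg_cong[where f = "cprob P x"] ext) auto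

lemma prod_pbar2_block_region:
  assumes "\<pi> \<in> pair_partitions I"
  shows "(\<Prod>b\<in>\<pi>. pbar2 P X x t (Min b) (Max b)) =
    (\<Prod>b\<in>\<pi>. cprob P x (\<lambda>\<omega>. \<forall>s\<in>{0..t}. X s \<omega> \<in> block_region b))"
proof (rule prod.cong[OF refl])
  fix b assume "b \<in> \<pi>"
  then obtain p q where pq: "p < q" "b = {p, q}" "Min b = p" "Max b = q"
    using pair_partition_blockE[OF assms] by metis
  have "pbar_upper P X x t p q = cprob P x (\<lambda>\<omega>. \<forall>s\<in>{0..t}. X s \<omega> \<in> block_region {p, q})"
    unfolding pbar_upper_def block_region_pair[OF pq(1)]
    by (intro arg_cong[where f = "cprob P x"] ext) auto
  then show "pbar2 P X x t (Min b) (Max b) = cprob P x (\<lambda>\<omega>. \<forall>s\<in>{0..t}. X s \<omega> \<in> block_region b)"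
    using pq by (simp add: pbar2_def)
qed

theorem mainTheorem11:
  fixes M :: "'w measure"
    and P :: "real ^ 'k::{finite,linorder} \<Rightarrow> 'w measure"
    and X :: "real \<Rightarrow> 'w \<Rightarrow> real ^ 'k::{finite,linorder}"
    and x :: "real ^ 'k::{finite,linorder}" and t :: real
  assumes "CARD('k) \<ge> 2"
    and "reflectable M P X"
    and "independent_orthogonal_components P X"
    and "x \<in> alcove_B"
    and "t \<ge> 0"
  shows "cprob P x (\<lambda>\<omega>. exit_time X alcove_B \<omega> > ennreal t) =
    (if even CARD('k) then Pf (pbar2 P X x t) UNIV
     else (\<Sum>l\<in>UNIV. (-1) ^ card {..<l} * pbar1 P X x t l * Pf (pbar2 P X x t) (UNIV - {l})))"
proof -
  have csm: "continuous_strong_markov M P X"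
    using assms(2) by (auto simp: reflectable_def continuous_strong_markov_def)
  define h where "h \<theta> = cprob P x (\<lambda>\<omega>. \<forall>s\<in>{0..t}. X s \<omega> \<in> config_region \<theta>)" for \<theta>
  have "alcove_B \<noteq> (UNIV :: (real ^ 'k::{finite,linorder}) set)"
    by (auto simp: alcove_B_def set_eq_iff intro!: exI[of _ 0])
  then have "cprob P x (\<lambda>\<omega>. exit_time X alcove_B \<omega> > ennreal t) = (\<Sum>\<theta>\<in>configs. config_sign \<theta> * h \<theta>)"
    unfolding h_def using assms(2)
    by (intro continuous_strong_markov.exit_expansion[OF csm] reflection_cancels[OF assms(1) csm]
        open_alcove finite_configs open_config_region config_region_ne_UNIV sum_config_sign
        alcove_subset_config_region[OF assms(1)] assms(4,5))
      (auto simp: reflectable_def)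
  also have "\<dots> = (if even CARD('k) then \<Sum>\<pi>\<in>pair_partitions UNIV. (-1) ^ crossings \<pi> * h ({}, \<pi>)
     else \<Sum>l\<in>UNIV. (-1) ^ card {..<l} *
       (\<Sum>\<pi>\<in>pair_partitions (UNIV - {l}). (-1) ^ crossings \<pi> * h ({l}, \<pi>)))"
    by (rule sum_configs)
  also have "\<dots> = (if even CARD('k) then Pf (pbar2 P X x t) UNIV
     else (\<Sum>l\<in>UNIV. (-1) ^ card {..<l} * pbar1 P X x t l * Pf (pbar2 P X x t) (UNIV - {l})))"
  proof (cases "even CARD('k)")
    case True
    have "h ({}, \<pi>) = (\<Prod>b\<in>\<pi>. pbar2 P X x t (Min b) (Max b))" if \<pi>: "\<pi> \<in> pair_partitions UNIV" for \<pi>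
    proof -
      have "({}, \<pi>) \<in> configs" using \<pi> True by (simp add: configs_def)
      then show ?thesis
        unfolding h_def using cprob_config_region[OF csm assms(3) _ assms(5)]
        by (simp add: prod_pbar2_block_region[OF \<pi>] config_blocks_def)
    qed
    then show ?thesis using True by (simp add: Pf_def)
  next
    case False
    have "h ({l}, \<pi>) = pbar1 P X x t l * (\<Prod>b\<in>\<pi>. pbar2 P X x t (Min b) (Max b))"
      if \<pi>: "\<pi> \<in> pair_partitions (UNIV - {l})" for l \<pi>
    proof -
      have "({l}, \<pi>) \<in> configs" using \<pi> False by (simp add: configs_def odd_iff_mod_2_eq_one Compl_eq_Diff_UNIV)
      moreover have "{l} \<notin> \<pi>" using \<pi> by (auto simp: pair_partitions_def)
      moreover have "finite \<pi>" using \<pi> by (rule finite_pair_partition[rotated]) simp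
      ultimately show ?thesis
        unfolding h_def using cprob_config_region[OF csm assms(3) _ assms(5)]
        by (simp add: prod_pbar2_block_region[OF \<pi>] pbar1_block_region config_blocks_def)
    qed
    then show ?thesis using False by (simp add: Pf_def sum_distrib_left mult_ac)
  qed
  finally show ?thesis .
qed

end
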